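(* Let $p_{\mathrm{ref}}$ be a probability distribution on a measurable space $\mathcal{Y}$ of outputs, let $f$ be a measurable map from $\mathcal{Y}$ to a set of final answers, let $r:\mathcal{Y}\to\mathbb{R}$ be a measurable reward function, and let $Y_1,Y_2,\ldots$ be i.i.d. with law $p_{\mathrm{ref}}$. Let $\pi_{\mathrm{ref}}$ be the law of $f(Y)$ for $Y\sim p_{\mathrm{ref}}$. Let $\pi_m$ be the Best-of-$m$ answer distribution and $\hat\pi_{m,N}$ its bootstrap estimate from $Y_1,\ldots,Y_N$, as defined in the context. Assume that $f(Y)$ has only finitely many possible values (values $z$ with $\pi_{\mathrm{ref}}(z)>0$). Assume that every possible value $z$ satisfies $\pi_{\mathrm{ref}}(z)\in(0,1)$ and the following. Let $F_0^z$ and $F_1^z$ be the CDFs of the conditional distributions of $r(Y)$ given $f(Y)=z$ and given $f(Y)\neq z$, respectively, and let $$x_0^z=\sup\{x\in\mathbb{R}:F_0^z(x)<1\},\qquad x_1^z=\sup\{x\in\mathbb{R}:F_1^z(x)<1\}$$ in $(-\infty,\infty]$. Then at least one of these conditions holds: (i) $x_0^z<x_1^z$; (ii) $x_0^z>x_1^z$; (iii) $x_0^z=x_1^z=:x^*$, the function $F_i^z$ is continuous and is strictly increasing on $\{x\in\mathbb{R}:0<F_i^z(x)<1\}$ for $i=0,1$, and there is $c\in[0,\infty]$ (possibly depending on $z$) such that $$\lim_{x\uparrow x^*}\frac{1-F_0^z(x)}{1-F_1^z(x)}=c.$$ Let $m=m(N)$ be a sequence of positive integers such that $m\to\infty$ and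 $m/N\to0$ as $N\to\infty$. Then for every $\epsilon>0$, $$\lim_{N\to\infty}\mathbb{P}\left(\left\|\hat\pi_{m,N}-\pi_m\right\|_1\ge\epsilon\right)=0.$$
   Context: Best-of-$m$: given outputs $y_1,\ldots,y_m\in\mathcal{Y}$, Best-of-$m$ returns the final answer $f(y)$ of an output $y\in\arg\max_{y\in\{y_1,\ldots,y_m\}}r(y)$ with the highest reward. Ties in the $\arg\max$ are broken by an arbitrary fixed measurable rule. $\pi_m$ is the law of $Z^{\mathrm{Best}}_m$, the answer returned by Best-of-$m$ on i.i.d. outputs $Y_1,\ldots,Y_m\sim p_{\mathrm{ref}}$. Thus $\pi_m(z)=\mathbb{P}(Z^{\mathrm{Best}}_m=z)$. Bootstrap estimate: given $Y_1,\ldots,Y_N$, let $\hat Y_1,\ldots,\hat Y_m$ be conditionally i.i.d. draws from the empirical distribution of $Y_1,\ldots,Y_N$, i.e. $m$ draws uniformly with replacement from the pool. The random distribution $\hat\pi_{m,N}$ is the conditional law, given $Y_1,\ldots,Y_N$, of the answer returned by Best-of-$m$ on $\hat Y_1,\ldots,\hat Y_m$. For distributions $\mu,\nu$ on the final answers, $\|\mu-\nu\|_1=\sum_z|\mu(z)-\nu(z)|$. *)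

theory Defs
  imports "HOL-Probability.Probability"
begin

text \<open>
  Throughout, \<open>M\<close> is the law of a single output, \<open>A\<close> is the measurable space of final answers and
  \<open>f\<close> maps an output to its final answer.
\<close>

definition possible_answers :: "'y measure \<Rightarrow> 'a measure \<Rightarrow> ('y \<Rightarrow> 'a) \<Rightarrow> 'a set" where
  "possible_answers M A f = {z \<in> space A. measure (distr M A f) {z} > 0}"

definition cond_cdf :: "'y measure \<Rightarrow> ('y \<Rightarrow> real) \<Rightarrow> ('y \<Rightarrow> bool) \<Rightarrow> real \<Rightarrow> real" where
  "cond_cdf M r E = cdf (distr (uniform_measure M {y \<in> space M. E y}) borel r)"

definition right_endpoint :: "(real \<Rightarrow> real) \<Rightarrow> ereal" where
  "right_endpoint F = (SUP x\<in>{x. F x < 1}. ereal x)"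

text \<open>The filter of real numbers increasing to \<open>x\<close>, where \<open>x = \<infinity>\<close> is allowed.\<close>

definition real_at_left :: "ereal \<Rightarrow> real filter" where
  "real_at_left x = filtercomap ereal (at_left x)"

lemma filtercomap_filtermap_inj: "inj g \<Longrightarrow> filtercomap g (filtermap g F) = F"
proof (rule antisym)
  assume g: "inj g"
  show "filtercomap g (filtermap g F) \<le> F"
  proof (rule filter_leI)
    fix P assume P: "eventually P F"
    have "eventually (\<lambda>y. \<forall>x. g x = y \<longrightarrow> P x) (filtermap g F)"
      unfolding eventually_filtermap
      by (rule eventually_mono[OF P]) (use g in \<open>auto dest: injD\<close>)
    then show "eventually P (filtercomap g (filtermap g F))"
      unfolding eventually_filtercomap by blast
  qed
qed (rule filtercomap_filtermap)

lemma real_at_left_ereal [simp]: "real_at_left (ereal x) = at_left x"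
  by (simp add: real_at_left_def at_left_ereal filtercomap_filtermap_inj)

lemma real_at_left_PInf [simp]: "real_at_left \<infinity> = at_top"
  by (simp add: real_at_left_def at_left_PInf filtercomap_filtermap_inj)

text \<open>
  A deterministic measurable way of choosing, for every \<open>m > 0\<close>, an output of maximal reward among
  \<open>m\<close> outputs. The choice may depend on the order in which the outputs are listed.
\<close>

definition best_of_rule ::
  "'y measure \<Rightarrow> ('y \<Rightarrow> real) \<Rightarrow> (nat \<Rightarrow> (nat \<Rightarrow> 'y) \<Rightarrow> 'y) \<Rightarrow> bool" where
  "best_of_rule M r best \<longleftrightarrow>
     (\<forall>m>0. best m \<in> measurable (Pi\<^sub>M {..<m} (\<lambda>_. M)) M \<and>
       (\<forall>y \<in> space (Pi\<^sub>M {..<m} (\<lambda>_. M)). is_arg_max r (\<lambda>u. u \<in> y ` {..<m}) (best m y)))"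

text \<open>The law of the Best-of-\<open>m\<close> answer on \<open>m\<close> i.i.d. outputs of law \<open>Q\<close>.\<close>

definition best_of_law ::
  "'a measure \<Rightarrow> ('y \<Rightarrow> 'a) \<Rightarrow> (nat \<Rightarrow> (nat \<Rightarrow> 'y) \<Rightarrow> 'y) \<Rightarrow> nat \<Rightarrow> 'y measure \<Rightarrow> 'a measure" where
  "best_of_law A f best m Q = distr (Pi\<^sub>M {..<m} (\<lambda>_. Q)) A (\<lambda>y. f (best m y))"

definition empirical :: "'y measure \<Rightarrow> nat \<Rightarrow> (nat \<Rightarrow> 'y) \<Rightarrow> 'y measure" where
  "empirical M N y = distr (uniform_count_measure {..<N}) M y"

text \<open>
  The bootstrap estimate from the pool \<open>y 0, \<dots>, y (N - 1)\<close>. Given the pool, the resampled outputs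
  are i.i.d. with the empirical law, so this is an explicit version of the conditional law.
\<close>

definition bootstrap_law ::
  "'y measure \<Rightarrow> 'a measure \<Rightarrow> ('y \<Rightarrow> 'a) \<Rightarrow> (nat \<Rightarrow> (nat \<Rightarrow> 'y) \<Rightarrow> 'y) \<Rightarrow> nat \<Rightarrow> nat \<Rightarrow>
    (nat \<Rightarrow> 'y) \<Rightarrow> 'a measure" where
  "bootstrap_law M A f best m N y = best_of_law A f best m (empirical M N y)"

definition l1_dist :: "'a measure \<Rightarrow> 'a measure \<Rightarrow> 'a measure \<Rightarrow> real" where
  "l1_dist A \<mu> \<nu> = (\<Sum>\<^sub>\<infinity>z\<in>space A. \<bar>measure \<mu> {z} - measure \<nu> {z}\<bar>)"

end

theory Submission
  imports Defs
begin

text \<open>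
  Write the bootstrap estimate as the average over all resamples \<open>a\<close>, i.e. maps from \<open>{..<k}\<close> to
  \<open>{..<N}\<close>, of the indicator that Best-of-\<open>k\<close> on the outputs selected by \<open>a\<close> answers \<open>z\<close>.

  If the law of the reward has no atoms, the second moment of the estimation error is an average of
  correlations over pairs \<open>(a, b)\<close>. Replacing by fresh outputs all positions where \<open>a\<close> or \<open>b\<close> collide
  makes the two answers independent, with exactly the Best-of-\<open>k\<close> law. By exchangeability each of the
  at least \<open>k\<close> outputs involved is the best one with probability at most \<open>1/k\<close>, so the replacement
  changes an answer with probability at most \<open>2/k\<close> per collision. As there are at most
  \<open>4k\<^sup>2/N\<close> collisions on average, the second moment is at most \<open>8k/N\<close>.

  If the right endpoints differ, some reward level is exceeded with positive probability, but only by
  outputs on one side (answer \<open>z\<close>, or answer other than \<open>z\<close>). Both the true and the estimated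
  probability of the other side then tend to \<open>0\<close>, whatever the rule for breaking ties.
\<close>

section \<open>Draws with replacement as a uniform random index map\<close>

text \<open>In a finite power each singleton is a box, so the product sigma-algebra is discrete;
  comparing the two measures on boxes then suffices. This turns the \<open>k\<close> bootstrap draws
  into one uniform choice of a map from positions to pool indices.\<close>

lemma PiM_uniform_count_measure:
  assumes I: "finite I" and B: "finite B" "B \<noteq> {}"
  shows "Pi\<^sub>M I (\<lambda>_. uniform_count_measure B) = uniform_count_measure (Pi\<^sub>E I (\<lambda>_. B))"
proof -
  interpret U: prob_space "uniform_count_measure B"
    using B by (rule prob_space_uniform_count_measure)
  interpret product_sigma_finite "\<lambda>_. uniform_count_measure B"
    by unfold_locales
  have fin: "finite (Pi\<^sub>E I (\<lambda>_. B))"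
    using I B by (simp add: finite_PiE)
  have ne: "Pi\<^sub>E I (\<lambda>_. B) \<noteq> {}"
    using B by (simp add: PiE_eq_empty_iff)
  show ?thesis
  proof (rule PiM_eqI[OF I, symmetric])
    have single: "{a} \<in> sets (Pi\<^sub>M I (\<lambda>_. uniform_count_measure B))" if "a \<in> Pi\<^sub>E I (\<lambda>_. B)" for a
    proof -
      have "{a} = Pi\<^sub>E I (\<lambda>i. {a i})"
        using that by (auto simp: PiE_iff extensional_def fun_eq_iff) metis
      then show ?thesis
        using that by (auto intro!: sets_PiM_I_finite I simp: sets_uniform_count_measure)
    qed
    have "X \<in> sets (Pi\<^sub>M I (\<lambda>_. uniform_count_measure B))" if "X \<subseteq> Pi\<^sub>E I (\<lambda>_. B)" for X
    proof -
      have "(\<Union>a\<in>X. {a}) \<in> sets (Pi\<^sub>M I (\<lambda>_. uniform_count_measure B))"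
        using that fin single by (intro sets.finite_UN) (auto intro: finite_subset)
      then show ?thesis by simp
    qed
    moreover have "X \<subseteq> Pi\<^sub>E I (\<lambda>_. B)" if "X \<in> sets (Pi\<^sub>M I (\<lambda>_. uniform_count_measure B))" for X
      using sets.sets_into_space[OF that] by (simp add: space_PiM space_uniform_count_measure)
    ultimately
    show "sets (uniform_count_measure (Pi\<^sub>E I (\<lambda>_. B))) = sets (Pi\<^sub>M I (\<lambda>_. uniform_count_measure B))"
      by (auto simp: sets_uniform_count_measure)
  next
    fix A assume A: "\<And>i. i \<in> I \<Longrightarrow> A i \<in> sets (uniform_count_measure B)"
    then have sub: "A i \<subseteq> B" if "i \<in> I" for i
      using that by (auto simp: sets_uniform_count_measure)
    have "emeasure (uniform_count_measure (Pi\<^sub>E I (\<lambda>_. B))) (Pi\<^sub>E I A) =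
        ennreal (\<Prod>i\<in>I. real (card (A i)) / real (card B))"
      using sub I fin by (subst emeasure_uniform_count_measure)
        (auto simp: card_PiE prod_dividef intro!: PiE_mono)
    also have "\<dots> = (\<Prod>i\<in>I. emeasure (uniform_count_measure B) (A i))"
      using sub B by (simp add: emeasure_uniform_count_measure prod_ennreal)
    finally show "emeasure (uniform_count_measure (Pi\<^sub>E I (\<lambda>_. B))) (Pi\<^sub>E I A) =
        (\<Prod>i\<in>I. emeasure (uniform_count_measure B) (A i))" .
  qed
qed

section \<open>I.i.d. samples\<close>

text \<open>The sequence \<open>Y\<close> is infinite, so that outputs with indices beyond the pool
  are available as fresh independent copies.\<close>

locale iid_sample = prob_space P for P :: "'w measure" +
  fixes M :: "'y measure" and Y :: "nat \<Rightarrow> 'w \<Rightarrow> 'y"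
  assumes indep: "indep_vars (\<lambda>_. M) Y UNIV"
    and law: "\<And>i. distr P M (Y i) = M"
begin

lemma measurable_Y [measurable]: "Y i \<in> measurable P M"
  using indep by (auto simp: indep_vars_def)

sublocale M: prob_space M
  using prob_space_distr[OF measurable_Y[of 0]] by (simp add: law)

lemma space_Y: "\<omega> \<in> space P \<Longrightarrow> Y i \<omega> \<in> space M"
  using measurable_Y by (rule measurable_space)

text \<open>The whole sequence has the product law, and an injective reindexing of a product of
  equal factors is again such a product.\<close>

lemma distr_reindex:
  assumes J: "finite J" and a: "inj_on a J"
  shows "distr P (Pi\<^sub>M J (\<lambda>_. M)) (\<lambda>\<omega>. \<lambda>j\<in>J. Y (a j) \<omega>) = Pi\<^sub>M J (\<lambda>_. M)"
proof -
  have "distr P (Pi\<^sub>M (UNIV :: nat set) (\<lambda>_. M)) (\<lambda>\<omega>. \<lambda>i\<in>UNIV. Y i \<omega>) =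
      Pi\<^sub>M UNIV (\<lambda>i. distr P M (Y i))"
    using indep by (subst (asm) indep_vars_iff_distr_eq_PiM) auto
  then have Y: "distr P (Pi\<^sub>M (UNIV :: nat set) (\<lambda>_. M)) (\<lambda>\<omega> i. Y i \<omega>) = Pi\<^sub>M UNIV (\<lambda>_. M)"
    by (simp add: law restrict_UNIV)
  have "Pi\<^sub>M J (\<lambda>_. M) =
      distr (Pi\<^sub>M (UNIV :: nat set) (\<lambda>_. M)) (Pi\<^sub>M J (\<lambda>_. M)) (\<lambda>y. \<lambda>j\<in>J. y (a j))"
    using a by (intro distr_PiM_reindex[symmetric]) (auto intro: M.prob_space_axioms)
  also have "\<dots> = distr P (Pi\<^sub>M J (\<lambda>_. M)) (\<lambda>\<omega>. \<lambda>j\<in>J. Y (a j) \<omega>)"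
    by (subst Y[symmetric], subst distr_distr)
      (auto simp: comp_def space_Y intro!: measurable_PiM_single')
  finally show ?thesis by simp
qed

lemma prob_Ball_Y:
  assumes J: "finite J" and S: "S \<in> sets M"
  shows "prob {\<omega> \<in> space P. \<forall>j\<in>J. Y j \<omega> \<in> S} = measure M S ^ card J"
proof (cases "J = {}")
  case False
  have "prob (\<Inter>j\<in>J. Y j -` S \<inter> space P) = (\<Prod>j\<in>J. prob (Y j -` S \<inter> space P))"
    using indep_varsD[OF indep False J, of "\<lambda>_. S"] S by simp
  also have "(\<Inter>j\<in>J. Y j -` S \<inter> space P) = {\<omega> \<in> space P. \<forall>j\<in>J. Y j \<omega> \<in> S}"
    using False by auto
  also have "(\<Prod>j\<in>J. prob (Y j -` S \<inter> space P)) = (\<Prod>j\<in>J. measure M S)"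
    using measure_distr[OF measurable_Y S] by (simp add: law)
  finally show ?thesis by simp
qed (simp add: prob_space)

lemma AE_all_Y:
  assumes "AE y in M. Q y"
  shows "AE \<omega> in P. \<forall>i. Q (Y i \<omega>)"
  unfolding AE_all_countable
proof
  fix i
  show "AE \<omega> in P. Q (Y i \<omega>)"
    using AE_distrD[OF measurable_Y[of i], of Q] assms unfolding law by simp
qed

text \<open>Disjoint blocks of an independent family are independent, and each selection is a
  measurable function of its block. Repeated indices within \<open>a\<close> or within
  \<open>b\<close> are allowed.\<close>

lemma indep_var_selections:
  assumes disj: "a ` I \<inter> b ` J = {}"
  shows "indep_var (Pi\<^sub>M I (\<lambda>_. M)) (\<lambda>\<omega>. \<lambda>j\<in>I. Y (a j) \<omega>) (Pi\<^sub>M J (\<lambda>_. M)) (\<lambda>\<omega>. \<lambda>j\<in>J. Y (b j) \<omega>)"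
proof -
  have "indep_var (Pi\<^sub>M (a ` I) (\<lambda>_. M)) (\<lambda>\<omega>. \<lambda>i\<in>a ` I. Y i \<omega>) (Pi\<^sub>M (b ` J) (\<lambda>_. M)) (\<lambda>\<omega>. \<lambda>i\<in>b ` J. Y i \<omega>)"
    using disj by (intro indep_var_restrict[OF indep]) auto
  then have "indep_var (Pi\<^sub>M I (\<lambda>_. M)) ((\<lambda>y. \<lambda>j\<in>I. y (a j)) \<circ> (\<lambda>\<omega>. \<lambda>i\<in>a ` I. Y i \<omega>))
      (Pi\<^sub>M J (\<lambda>_. M)) ((\<lambda>y. \<lambda>j\<in>J. y (b j)) \<circ> (\<lambda>\<omega>. \<lambda>i\<in>b ` J. Y i \<omega>))"
    by (rule indep_var_compose) measurable
  moreover have "(\<lambda>y. \<lambda>j\<in>I. y (a j)) \<circ> (\<lambda>\<omega>. \<lambda>i\<in>a ` I. Y i \<omega>) = (\<lambda>\<omega>. \<lambda>j\<in>I. Y (a j) \<omega>)"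
    "(\<lambda>y. \<lambda>j\<in>J. y (b j)) \<circ> (\<lambda>\<omega>. \<lambda>i\<in>b ` J. Y i \<omega>) = (\<lambda>\<omega>. \<lambda>j\<in>J. Y (b j) \<omega>)"
    by (auto simp: fun_eq_iff)
  ultimately show ?thesis by simp
qed

text \<open>By Fubini: once the first output is fixed, the second one hits its reward with
  probability 0. There are only countably many pairs of indices.\<close>

lemma AE_distinct_Y:
  fixes r :: "'y \<Rightarrow> real"
  assumes r [measurable]: "r \<in> borel_measurable M"
    and no_atom: "\<And>t. measure M {y \<in> space M. r y = t} = 0"
  shows "AE \<omega> in P. \<forall>i j. i \<noteq> j \<longrightarrow> r (Y i \<omega>) \<noteq> r (Y j \<omega>)"
  unfolding AE_all_countable
proof (intro allI)
  fix i j
  interpret MM: pair_sigma_finite M M ..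
  show "AE \<omega> in P. i \<noteq> j \<longrightarrow> r (Y i \<omega>) \<noteq> r (Y j \<omega>)"
  proof (cases "i = j")
    case False
    \<comment> \<open>Pairwise independence is read off from the block version, with the singletons
      \<open>{i}\<close> and \<open>{j}\<close> as blocks.\<close>
    have "indep_var M ((\<lambda>y. y i) \<circ> (\<lambda>\<omega>. \<lambda>k\<in>{i}. Y k \<omega>)) M ((\<lambda>y. y j) \<circ> (\<lambda>\<omega>. \<lambda>k\<in>{j}. Y k \<omega>))"
      using False by (intro indep_var_compose[OF indep_var_selections[where a=id and b=id, simplified]]) auto
    then have "indep_var M (Y i) M (Y j)"
      by (simp add: comp_def)
    then have "distr P (M \<Otimes>\<^sub>M M) (\<lambda>\<omega>. (Y i \<omega>, Y j \<omega>)) = M \<Otimes>\<^sub>M M"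
      by (simp add: indep_var_distribution_eq law)
    moreover have "AE p in M \<Otimes>\<^sub>M M. r (fst p) \<noteq> r (snd p)"
    proof (rule MM.AE_pair_measure)
      show "AE x in M. AE y in M. r (fst (x, y)) \<noteq> r (snd (x, y))"
      proof (rule AE_I2)
        fix x
        have "AE y in M. y \<notin> {y \<in> space M. r y = r x}"
          using no_atom[of "r x"] by (subst M.prob_eq_0[symmetric]) auto
        then show "AE y in M. r (fst (x, y)) \<noteq> r (snd (x, y))"
          using AE_space by eventually_elim auto
      qed
    qed measurable
    ultimately have "AE p in distr P (M \<Otimes>\<^sub>M M) (\<lambda>\<omega>. (Y i \<omega>, Y j \<omega>)). r (fst p) \<noteq> r (snd p)"
      by (simp only:)
    from AE_distrD[OF _ this] show ?thesis
      by simp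
  qed simp
qed

text \<open>Exchangeability gives all indices in \<open>S\<close> the same chance of being the best
  one, and almost surely at most one index is best.\<close>

lemma prob_argmax_le:
  fixes r :: "'y \<Rightarrow> real"
  assumes r [measurable]: "r \<in> borel_measurable M"
    and no_atom: "\<And>t. measure M {y \<in> space M. r y = t} = 0"
    and S: "finite S" "i \<in> S"
  shows "prob {\<omega> \<in> space P. \<forall>j\<in>S. r (Y j \<omega>) \<le> r (Y i \<omega>)} \<le> 1 / card S"
proof -
  define E where "E k = {\<omega> \<in> space P. \<forall>j\<in>S. r (Y j \<omega>) \<le> r (Y k \<omega>)}" for k
  have E [measurable]: "E k \<in> events" for k
    unfolding E_def using S by measurable
  have exchange: "prob (E k) = prob (E i)" if k: "k \<in> S" for k
  proof -
    \<comment> \<open>This permutation of \<open>S\<close> sends \<open>i\<close> to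
      \<open>k\<close>. Permuting the outputs in \<open>S\<close> leaves their joint law unchanged,
      so \<open>E i\<close> and \<open>E k\<close> are the same event \<open>?G\<close> seen through
      two permutations.\<close>
    let ?t = "Transposition.transpose i k"
    let ?G = "{y \<in> space (Pi\<^sub>M S (\<lambda>_. M)). \<forall>j\<in>S. r (y j) \<le> r (y i)}"
    have "(\<lambda>y. r (y j)) \<in> borel_measurable (Pi\<^sub>M S (\<lambda>_. M))" if "j \<in> S" for j
      using that by measurable
    then have G [measurable]: "?G \<in> sets (Pi\<^sub>M S (\<lambda>_. M))"
      using S by (intro sets.sets_Collect_finite_All borel_measurable_le) auto
    have "prob (E (a i)) = measure (Pi\<^sub>M S (\<lambda>_. M)) ?G" if a: "bij_betw a S S" for a
    proof -
      have "measure (Pi\<^sub>M S (\<lambda>_. M)) ?G =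
          measure (distr P (Pi\<^sub>M S (\<lambda>_. M)) (\<lambda>\<omega>. \<lambda>j\<in>S. Y (a j) \<omega>)) ?G"
        using S a by (subst distr_reindex) (auto simp: bij_betw_def)
      also have "\<dots> = prob ((\<lambda>\<omega>. \<lambda>j\<in>S. Y (a j) \<omega>) -` ?G \<inter> space P)"
        by (rule measure_distr) measurable
      also have "(\<lambda>\<omega>. \<lambda>j\<in>S. Y (a j) \<omega>) -` ?G \<inter> space P =
          {\<omega> \<in> space P. \<forall>j\<in>S. r (Y (a j) \<omega>) \<le> r (Y (a i) \<omega>)}"
        using S by (auto simp: space_PiM space_Y)
      also have "\<dots> = {\<omega> \<in> space P. \<forall>j\<in>a ` S. r (Y j \<omega>) \<le> r (Y (a i) \<omega>)}"
        by auto
      also have "a ` S = S"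
        using a by (simp add: bij_betw_def)
      finally show ?thesis by (simp add: E_def)
    qed
    from this[of id] this[of ?t] show ?thesis
      using S k by simp
  qed
  \<comment> \<open>This is the expected number of maximising indices in \<open>S\<close>; two of
    them would have equal rewards, which happens with probability 0.\<close>
  have "real (card S) * prob (E i) = (\<Sum>k\<in>S. prob (E k))"
    by (simp add: exchange)
  also have "\<dots> = (\<integral>\<omega>. (\<Sum>k\<in>S. indicator (E k) \<omega>) \<partial>P)"
    by (subst Bochner_Integration.integral_sum)
      (auto intro!: integrable_real_indicator simp: less_top[symmetric])
  also have "\<dots> \<le> (\<integral>\<omega>. 1 \<partial>P)"
  proof (rule integral_mono_AE)
    show "AE \<omega> in P. (\<Sum>k\<in>S. indicator (E k) \<omega>) \<le> (1::real)"
      using AE_distinct_Y[OF r no_atom]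
    proof eventually_elim
      case (elim \<omega>)
      have "(\<Sum>k\<in>S. indicator (E k) \<omega>) = real (card {k\<in>S. \<omega> \<in> E k})"
        using S by (simp add: indicator_def sum.If_cases Int_def)
      moreover have "k = l" if "k \<in> S" "l \<in> S" "\<omega> \<in> E k" "\<omega> \<in> E l" for k l
      proof -
        have "r (Y k \<omega>) = r (Y l \<omega>)"
          using that by (intro antisym) (auto simp: E_def)
        with elim show ?thesis by blast
      qed
      then have "card {k\<in>S. \<omega> \<in> E k} \<le> 1"
        using S by (auto simp: card_le_Suc0_iff_eq)
      ultimately show ?case by simp
    qed
  qed (auto intro!: Bochner_Integration.integrable_sum integrable_real_indicator simp: less_top[symmetric])
  also have "\<dots> = 1"
    by (simp add: prob_space)
  finally have "real (card S) * prob (E i) \<le> 1" .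
  moreover have "real (card S) > 0"
    using S by (auto simp: card_gt_0_iff)
  ultimately show ?thesis
    by (simp add: E_def pos_le_divide_eq mult.commute)
qed

end

section \<open>Collisions between resamples\<close>

text \<open>A map whose value at \<open>i\<close> is prescribed by its other values is determined by
  its restriction to \<open>I - {i}\<close>, so one factor \<open>card B\<close> is lost. Letting
  \<open>h\<close> see the whole map covers both a fixed value and a value copied from another
  coordinate.\<close>

lemma card_PiE_coordinate_le:
  assumes I: "finite I" "i \<in> I" and B: "finite B"
    and h: "\<And>b c. (\<And>j. j \<in> I - {i} \<Longrightarrow> b j = c j) \<Longrightarrow> h b = h c"
  shows "card {b \<in> Pi\<^sub>E I (\<lambda>_. B). b i = h b} * card B \<le> card B ^ card I"
proof -
  let ?X = "{b \<in> Pi\<^sub>E I (\<lambda>_. B). b i = h b}"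
  have "inj_on (\<lambda>b. restrict b (I - {i})) ?X"
  proof (rule inj_onI)
    fix b c
    assume b: "b \<in> ?X" and c: "c \<in> ?X" and eq: "restrict b (I - {i}) = restrict c (I - {i})"
    have *: "b j = c j" if "j \<in> I - {i}" for j
      using fun_cong[OF eq, of j] that by simp
    have "b i = c i"
      using b c h[of b c] * by simp
    with * have "b j = c j" if "j \<in> I" for j
      using that by (cases "j = i") auto
    then show "b = c"
      using b c by (intro PiE_ext[of b I "\<lambda>_. B" c]) auto
  qed
  then have "card ?X \<le> card (Pi\<^sub>E (I - {i}) (\<lambda>_. B))"
    by (rule card_inj_on_le) (use I B in \<open>auto simp: PiE_iff intro!: finite_PiE split: if_splits\<close>)
  also have "\<dots> = card B ^ (card I - 1)"
    using I by (simp add: card_PiE)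
  finally have "card ?X * card B \<le> card B ^ (card I - 1) * card B"
    by simp
  also have "\<dots> = card B ^ card I"
    using I by (intro power_minus_mult) (auto simp: card_gt_0_iff)
  finally show ?thesis .
qed

text \<open>Outside these positions \<open>a\<close> is injective and avoids all indices used by
  \<open>b\<close>. The notion is not symmetric: to separate a pair of resamples, the collisions of
  \<open>a\<close> with \<open>b\<close> and those of \<open>b\<close> with \<open>a\<close> are
  both removed.\<close>

definition collisions :: "nat \<Rightarrow> (nat \<Rightarrow> nat) \<Rightarrow> (nat \<Rightarrow> nat) \<Rightarrow> nat set" where
  "collisions k a b = {j. j < k \<and> ((\<exists>i<k. i \<noteq> j \<and> a i = a j) \<or> (\<exists>i<k. b i = a j))}"

lemma finite_collisions [simp]: "finite (collisions k a b)"
  by (simp add: collisions_def)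

abbreviation resamples :: "nat \<Rightarrow> nat \<Rightarrow> (nat \<Rightarrow> nat) set" where
  "resamples k N \<equiv> Pi\<^sub>E {..<k} (\<lambda>_. {..<N})"

lemma finite_resamples [simp]: "finite (resamples k N)"
  by (simp add: finite_PiE)

lemma card_resamples [simp]: "card (resamples k N) = N ^ k"
  by (simp add: card_PiE)

text \<open>Union bound over pairs of positions: a fixed collision within \<open>a\<close>, or of
  \<open>a\<close> with \<open>b\<close>, prescribes one draw and so occurs for at most a share
  \<open>1/N\<close> of the pairs of resamples. Multiplying by \<open>N\<close> keeps the count in
  the natural numbers.\<close>

lemma sum_collisions_le:
  "(\<Sum>a\<in>resamples k N. \<Sum>b\<in>resamples k N. card (collisions k a b)) * N \<le> 2 * k\<^sup>2 * (N ^ k)\<^sup>2"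
proof -
  let ?F = "resamples k N"
  have count: "card {b \<in> ?F. b i = h b} * N \<le> N ^ k"
    if "i < k" "\<And>b c. (\<And>j. j \<in> {..<k} - {i} \<Longrightarrow> b j = c j) \<Longrightarrow> h b = h c" for i and h :: "(nat \<Rightarrow> nat) \<Rightarrow> nat"
    using card_PiE_coordinate_le[of "{..<k}" i "{..<N}" h, OF _ _ _ that(2)] that(1) by simp
  have self: "card {a \<in> ?F. i \<noteq> j \<and> a i = a j} * N \<le> N ^ k" if "i < k" "j < k" for i j
  proof (cases "i = j")
    case False
    then show ?thesis
      using count[of i "\<lambda>a. a j"] that by auto
  qed simp
  have "card (collisions k a b) \<le>
      (\<Sum>j<k. \<Sum>i<k. of_bool (i \<noteq> j \<and> a i = a j) + of_bool (b i = a j))" for a b :: "nat \<Rightarrow> nat"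
  proof -
    have "card (collisions k a b) = (\<Sum>j<k. of_bool (j \<in> collisions k a b))"
      by (simp add: of_bool_def sum.If_cases collisions_def Int_def)
    also have "\<dots> \<le> (\<Sum>j<k. \<Sum>i<k. of_bool (i \<noteq> j \<and> a i = a j) + of_bool (b i = a j))"
    proof (rule sum_mono)
      fix j
      show "of_bool (j \<in> collisions k a b) \<le>
          (\<Sum>i<k. of_bool (i \<noteq> j \<and> a i = a j) + of_bool (b i = a j) :: nat)"
      proof (cases "j \<in> collisions k a b")
        case True
        then obtain i where "i < k" "(i \<noteq> j \<and> a i = a j) \<or> b i = a j"
          by (auto simp: collisions_def)
        then have "1 \<le> (of_bool (i \<noteq> j \<and> a i = a j) + of_bool (b i = a j) :: nat)"
          by auto
        also have "\<dots> \<le> (\<Sum>i<k. of_bool (i \<noteq> j \<and> a i = a j) + of_bool (b i = a j))"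
          using \<open>i < k\<close> by (intro member_le_sum) auto
        finally show ?thesis using True by simp
      qed simp
    qed
    finally show ?thesis .
  qed
  then have "(\<Sum>a\<in>?F. \<Sum>b\<in>?F. card (collisions k a b)) \<le>
      (\<Sum>a\<in>?F. \<Sum>b\<in>?F. \<Sum>j<k. \<Sum>i<k. of_bool (i \<noteq> j \<and> a i = a j) + of_bool (b i = a j))"
    by (intro sum_mono)
  \<comment> \<open>With the positions outermost, each possible coincidence can be counted over the
    resamples separately.\<close>
  also have "\<dots> = (\<Sum>j<k. \<Sum>i<k. \<Sum>a\<in>?F. \<Sum>b\<in>?F.
      of_bool (i \<noteq> j \<and> a i = a j) + of_bool (b i = a j))"
    by (simp only: sum.swap[of _ "{..<k}" ?F])
  also have "\<dots> = (\<Sum>j<k. \<Sum>i<k.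
      card {a \<in> ?F. i \<noteq> j \<and> a i = a j} * N ^ k + (\<Sum>a\<in>?F. card {b \<in> ?F. b i = a j}))"
  proof (intro sum.cong refl)
    fix j i
    have of_bool_sum: "(\<Sum>a\<in>?F. of_bool (Q a) :: nat) = card {a \<in> ?F. Q a}" for Q
      by (simp add: of_bool_def sum.If_cases Int_def)
    have inner: "(\<Sum>b\<in>?F. of_bool c + of_bool (b i = v) :: nat) = of_bool c * N ^ k + card {b \<in> ?F. b i = v}"
      for c v
      by (simp only: sum.distrib of_bool_sum[of "\<lambda>b. b i = v"] sum_constant card_resamples)
        (simp add: mult.commute)
    show "(\<Sum>a\<in>?F. \<Sum>b\<in>?F. of_bool (i \<noteq> j \<and> a i = a j) + of_bool (b i = a j)) =
        card {a \<in> ?F. i \<noteq> j \<and> a i = a j} * N ^ k + (\<Sum>a\<in>?F. card {b \<in> ?F. b i = a j})"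
      unfolding inner by (simp only: sum.distrib sum_distrib_right[symmetric] of_bool_sum)
  qed
  finally have "(\<Sum>a\<in>?F. \<Sum>b\<in>?F. card (collisions k a b)) * N \<le>
      (\<Sum>j<k. \<Sum>i<k. (card {a \<in> ?F. i \<noteq> j \<and> a i = a j} * N) * N ^ k +
        (\<Sum>a\<in>?F. card {b \<in> ?F. b i = a j} * N))"
    by (drule_tac mult_le_mono1[where k = N])
      (simp only: sum_distrib_right distrib_right mult.assoc mult.commute[of N] mult.left_commute[of N])
  \<comment> \<open>The two kinds of collision contribute equal bounds for each of the
    \<open>k * k\<close> position pairs, whence the factor 2.\<close>
  also have "\<dots> \<le> (\<Sum>j<k. \<Sum>i<k. N ^ k * N ^ k + (\<Sum>a\<in>?F. N ^ k))"
  proof (intro sum_mono add_mono mult_le_mono1 self)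
    fix j i a
    assume "i \<in> {..<k}"
    then show "card {b \<in> ?F. b i = a j} * N \<le> N ^ k"
      using count[of i "\<lambda>_. a j"] by simp
  qed auto
  also have "\<dots> = 2 * k\<^sup>2 * (N ^ k)\<^sup>2"
    by (simp add: power2_eq_square algebra_simps)
  finally show ?thesis .
qed

lemma sum_collisions_real:
  assumes "N > 0"
  shows "(\<Sum>a\<in>resamples k N. \<Sum>b\<in>resamples k N. real (card (collisions k a b))) \<le> 2 * (real k)\<^sup>2 / N * (real N ^ k)\<^sup>2"
proof -
  have "real ((\<Sum>a\<in>resamples k N. \<Sum>b\<in>resamples k N. card (collisions k a b)) * N) \<le> real (2 * k\<^sup>2 * (N ^ k)\<^sup>2)"
    by (rule of_nat_mono) (rule sum_collisions_le)
  with assms show ?thesis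
    by (simp add: field_simps)
qed

section \<open>Replacing colliding positions by fresh indices\<close>

text \<open>The offset \<open>s\<close> is at least the pool size, so \<open>s + j\<close> points to
  an output outside the pool, a different one for each \<open>j\<close>. Offsets \<open>N\<close>
  and \<open>N + k\<close> are used for the two members of a pair, to keep their fresh indices
  apart.\<close>

definition refresh :: "nat \<Rightarrow> nat \<Rightarrow> (nat \<Rightarrow> nat) \<Rightarrow> (nat \<Rightarrow> nat) \<Rightarrow> nat \<Rightarrow> nat" where
  "refresh k s a b j = (if j \<in> collisions k a b then s + j else a j)"

text \<open>Fresh indices are at least \<open>s\<close> and distinct by construction, kept indices
  are below \<open>s\<close>, and two equal kept indices would be a collision.\<close>

lemma inj_on_refresh:
  assumes "\<And>j. j < k \<Longrightarrow> a j < s"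
  shows "inj_on (refresh k s a b) {..<k}"
proof (rule inj_onI)
  fix i j
  assume ij: "i \<in> {..<k}" "j \<in> {..<k}" and eq: "refresh k s a b i = refresh k s a b j"
  have lt: "a i < s" "a j < s"
    using ij assms by auto
  consider "i \<in> collisions k a b" | "j \<in> collisions k a b" | "i \<notin> collisions k a b" "j \<notin> collisions k a b"
    by blast
  then show "i = j"
  proof cases
    case 3
    then have "a i = a j"
      using eq by (simp add: refresh_def)
    with 3(1) ij show ?thesis
      unfolding collisions_def by auto
  qed (use eq lt in \<open>auto simp: refresh_def split: if_splits\<close>)
qed

text \<open>Kept indices lie below \<open>N\<close>, the fresh ones of \<open>a\<close> in
  \<open>{N..<N + k}\<close> and those of \<open>b\<close> from \<open>N + k\<close> on. A common
  index would thus be kept on both sides, hence a collision between \<open>a\<close> and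
  \<open>b\<close>.\<close>

lemma refresh_disjoint:
  assumes a: "\<And>j. j < k \<Longrightarrow> a j < N" and b: "\<And>j. j < k \<Longrightarrow> b j < N"
  shows "refresh k N a b ` {..<k} \<inter> refresh k (N + k) b a ` {..<k} = {}"
proof -
  have "refresh k N a b i \<noteq> refresh k (N + k) b a j" if ij: "i < k" "j < k" for i j
  proof
    assume eq: "refresh k N a b i = refresh k (N + k) b a j"
    have "a i < N" "b j < N"
      using a b ij by auto
    with eq ij have "i \<notin> collisions k a b" "a i = b j"
      by (auto simp: refresh_def split: if_splits)
    then show False
      using ij unfolding collisions_def by auto
  qed
  then show ?thesis by blast
qed

text \<open>Either \<open>c\<close> is at most half of \<open>k\<close>, or the last summand already
  exceeds 1. The bound is linear in \<open>c\<close>, so it can be averaged over collision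
  counts.\<close>

lemma power_diff_le:
  fixes q :: real
  assumes q: "0 \<le> q" "q \<le> 1" and k: "k > 0"
  shows "q ^ (k - c) \<le> q ^ (k div 2) + 2 * real c / real k"
proof (cases "2 * c \<le> k")
  case True
  then have "q ^ (k - c) \<le> q ^ (k div 2)"
    using q by (intro power_decreasing) auto
  then show ?thesis
    by (rule order_trans) simp
next
  case False
  have "q ^ (k - c) \<le> 1"
    using q by (rule power_le_one)
  also have "1 \<le> 2 * real c / real k"
    using False k by simp
  also have "\<dots> \<le> q ^ (k div 2) + 2 * real c / real k"
    using q by simp
  finally show ?thesis .
qed

section \<open>Conditional distribution functions and right endpoints\<close>

text \<open>Conditioning on an event of positive probability divides by that probability, and a
  distribution function is continuous exactly where its law has no atom. This translates the
  assumptions on conditional CDFs into probabilities under \<open>M\<close>.\<close>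

lemma cond_cdf_eq:
  assumes M: "prob_space M" and r [measurable]: "r \<in> borel_measurable M"
    and E: "{y \<in> space M. E y} \<in> sets M" "measure M {y \<in> space M. E y} > 0"
  shows "cond_cdf M r E x =
      measure M {y \<in> space M. E y \<and> r y \<le> x} / measure M {y \<in> space M. E y}" (is ?cdf)
    and "isCont (cond_cdf M r E) x \<longleftrightarrow> measure M {y \<in> space M. E y \<and> r y = x} = 0" (is ?cont)
proof -
  interpret M: prob_space M by fact
  let ?B = "{y \<in> space M. E y}"
  note [measurable] = E(1)
  have pos: "emeasure M ?B \<noteq> 0"
    using E(2) by (simp add: M.emeasure_eq_measure)
  interpret U: prob_space "uniform_measure M ?B"
    using pos by (intro prob_space_uniform_measure) auto
  interpret D: real_distribution "distr (uniform_measure M ?B) borel r"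
    by (intro U.real_distribution_distr) simp
  have eq: "measure (distr (uniform_measure M ?B) borel r) S =
      measure M {y \<in> space M. E y \<and> r y \<in> S} / measure M ?B" if S: "S \<in> sets borel" for S
  proof -
    have "r -` S \<inter> space M \<in> sets M"
      using S by measurable
    moreover have "?B \<inter> (r -` S \<inter> space M) = {y \<in> space M. E y \<and> r y \<in> S}"
      by auto
    ultimately show ?thesis
      using S pos by (simp add: measure_distr measure_uniform_measure)
  qed
  show ?cdf
    unfolding cond_cdf_def cdf_def by (subst eq) auto
  show ?cont
    unfolding cond_cdf_def D.isCont_cdf using E(2) by (subst eq) auto
qed

text \<open>A level \<open>x\<close> between the endpoints is exceeded with positive probability,
  but almost surely never on \<open>E0\<close>. The complementary event has its own name
  \<open>E1\<close> so that the two sides can be exchanged.\<close>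

lemma right_endpoint_less:
  assumes M: "prob_space M" and r [measurable]: "r \<in> borel_measurable M"
    and E0: "{y \<in> space M. E0 y} \<in> sets M" "measure M {y \<in> space M. E0 y} > 0"
    and E1: "{y \<in> space M. E1 y} \<in> sets M" "measure M {y \<in> space M. E1 y} > 0"
    and compl: "\<And>y. y \<in> space M \<Longrightarrow> E1 y \<longleftrightarrow> \<not> E0 y"
    and less: "right_endpoint (cond_cdf M r E0) < right_endpoint (cond_cdf M r E1)"
  obtains x where "measure M {y \<in> space M. r y \<le> x} < 1" "AE y in M. x < r y \<longrightarrow> \<not> E0 y"
proof -
  interpret M: prob_space M by fact
  note [measurable] = E0(1) E1(1)
  \<comment> \<open>The larger endpoint is a supremum over levels with
    \<open>cond_cdf M r E1 x < 1\<close>, so one such level lies above the smaller endpoint.\<close>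
  from less obtain x where x: "cond_cdf M r E1 x < 1" "right_endpoint (cond_cdf M r E0) < ereal x"
    unfolding right_endpoint_def[of "cond_cdf M r E1"] by (auto simp: less_SUP_iff)
  have "\<not> cond_cdf M r E0 x < 1"
  proof
    assume "cond_cdf M r E0 x < 1"
    then have "ereal x \<le> right_endpoint (cond_cdf M r E0)"
      unfolding right_endpoint_def by (intro SUP_upper) simp
    with x(2) show False by simp
  qed
  then have ge: "measure M {y \<in> space M. E0 y \<and> r y \<le> x} \<ge> measure M {y \<in> space M. E0 y}"
    using E0(2) by (simp add: cond_cdf_eq(1)[OF M r E0] not_less le_divide_eq)
  have lt: "measure M {y \<in> space M. E1 y \<and> r y \<le> x} < measure M {y \<in> space M. E1 y}"
    using x(1) E1(2) by (simp add: cond_cdf_eq(1)[OF M r E1] divide_less_eq)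
  have split: "measure M {y \<in> space M. Q y} = measure M {y \<in> space M. E0 y \<and> Q y} + measure M {y \<in> space M. E1 y \<and> Q y}"
    if [measurable]: "{y \<in> space M. Q y} \<in> sets M" for Q
  proof -
    have "{y \<in> space M. Q y} = {y \<in> space M. E0 y \<and> Q y} \<union> {y \<in> space M. E1 y \<and> Q y}"
      using compl by auto
    then show ?thesis
      using compl by (simp, subst M.finite_measure_Union) auto
  qed
  have "measure M {y \<in> space M. r y \<le> x} < 1"
  proof -
    have "measure M {y \<in> space M. E0 y \<and> r y \<le> x} \<le> measure M {y \<in> space M. E0 y}"
      by (intro M.finite_measure_mono) auto
    moreover have "measure M {y \<in> space M. E0 y} + measure M {y \<in> space M. E1 y} = 1"
      using split[of "\<lambda>_. True"] by (simp add: M.prob_space)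
    ultimately show ?thesis
      using lt split[of "\<lambda>y. r y \<le> x"] by simp
  qed
  moreover have "AE y in M. x < r y \<longrightarrow> \<not> E0 y"
  proof -
    have "measure M ({y \<in> space M. E0 y} - {y \<in> space M. E0 y \<and> r y \<le> x}) = 0"
      using ge by (subst M.finite_measure_Diff) (auto intro!: antisym M.finite_measure_mono)
    then have "AE y in M. y \<notin> {y \<in> space M. E0 y} - {y \<in> space M. E0 y \<and> r y \<le> x}"
      by (subst M.prob_eq_0[symmetric]) auto
    then show ?thesis
      using AE_space by eventually_elim auto
  qed
  ultimately show ?thesis by (rule that)
qed

section \<open>Best-of-\<open>k\<close> on samples and resamples\<close>

locale best_of = iid_sample P M Y
  for P :: "'w measure" and M :: "'y measure" and Y :: "nat \<Rightarrow> 'w \<Rightarrow> 'y" +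
  fixes A :: "'a measure" and f :: "'y \<Rightarrow> 'a" and r :: "'y \<Rightarrow> real"
    and best :: "nat \<Rightarrow> (nat \<Rightarrow> 'y) \<Rightarrow> 'y"
  assumes f [measurable]: "f \<in> measurable M A"
    and r [measurable]: "r \<in> borel_measurable M"
    and best_of_rule: "best_of_rule M r best"
begin

lemma measurable_best: "k > 0 \<Longrightarrow> best k \<in> measurable (Pi\<^sub>M {..<k} (\<lambda>_. M)) M"
  using best_of_rule by (auto simp: best_of_rule_def)

lemma measurable_f_best: "k > 0 \<Longrightarrow> (\<lambda>y. f (best k y)) \<in> measurable (Pi\<^sub>M {..<k} (\<lambda>_. M)) A"
  by (rule measurable_compose[OF measurable_best f])

lemma best_is_max:
  assumes k: "k > 0" and y: "y \<in> space (Pi\<^sub>M {..<k} (\<lambda>_. M))"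
  shows "\<exists>j<k. best k y = y j \<and> (\<forall>i<k. r (y i) \<le> r (y j))"
proof -
  have "is_arg_max r (\<lambda>u. u \<in> y ` {..<k}) (best k y)"
    using best_of_rule k y by (auto simp: best_of_rule_def)
  then show ?thesis
    by (auto simp: is_arg_max_def not_less)
qed

text \<open>Here \<open>a\<close> is any map from positions to indices, so true samples
  (\<open>a\<close> injective), resamples of the pool and refreshed resamples are all treated on the
  one space \<open>P\<close>.\<close>

definition answer :: "nat \<Rightarrow> (nat \<Rightarrow> nat) \<Rightarrow> 'w \<Rightarrow> 'a" where
  "answer k a \<omega> = f (best k (\<lambda>j\<in>{..<k}. Y (a j) \<omega>))"

lemma measurable_answer [measurable]: "k > 0 \<Longrightarrow> answer k a \<in> measurable P A"
  unfolding answer_def[abs_def]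
  by (rule measurable_compose[OF _ measurable_f_best]) measurable

lemma answer_is_max:
  assumes "k > 0" "\<omega> \<in> space P"
  shows "\<exists>j<k. answer k a \<omega> = f (Y (a j) \<omega>) \<and> (\<forall>i<k. r (Y (a i) \<omega>) \<le> r (Y (a j) \<omega>))"
proof -
  have "(\<lambda>j\<in>{..<k}. Y (a j) \<omega>) \<in> space (Pi\<^sub>M {..<k} (\<lambda>_. M))"
    using assms by (auto simp: space_PiM space_Y)
  from best_is_max[OF assms(1) this] show ?thesis
    by (auto simp: answer_def)
qed

text \<open>Distinct indices select i.i.d. outputs, so any injective \<open>a\<close> realises the
  exact Best-of-\<open>k\<close> law.\<close>

lemma prob_answer:
  assumes k: "k > 0" and a: "inj_on a {..<k}" and T: "T \<in> sets A"
  shows "prob {\<omega> \<in> space P. answer k a \<omega> \<in> T} = measure (best_of_law A f best k M) T"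
proof -
  have "best_of_law A f best k M =
      distr (distr P (Pi\<^sub>M {..<k} (\<lambda>_. M)) (\<lambda>\<omega>. \<lambda>j\<in>{..<k}. Y (a j) \<omega>)) A (\<lambda>y. f (best k y))"
    using a by (simp add: best_of_law_def distr_reindex)
  also have "\<dots> = distr P A (answer k a)"
    using measurable_f_best[OF k] by (subst distr_distr) (auto simp: comp_def answer_def[abs_def])
  finally show ?thesis
    using k T by (simp add: measure_distr vimage_def Int_def conj_commute)
qed

text \<open>A product of image measures is the image of the product, and the product of the uniform
  laws on pool indices is uniform on the \<open>N ^ k\<close> resamples.\<close>

lemma measure_bootstrap_law:
  assumes k: "k > 0" and N: "N > 0" and \<omega>: "\<omega> \<in> space P" and T: "T \<in> sets A"
  shows "measure (bootstrap_law M A f best k N (\<lambda>i. Y i \<omega>)) T =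
    (\<Sum>a\<in>resamples k N. indicator T (answer k a \<omega>)) / real N ^ k"
proof -
  let ?U = "uniform_count_measure {..<N}" and ?F = "resamples k N"
  interpret U: prob_space ?U
    using N by (intro prob_space_uniform_count_measure) auto
  have Y: "(\<lambda>i. Y i \<omega>) \<in> measurable ?U M"
    using \<omega> by (auto simp: measurable_def space_Y space_uniform_count_measure sets_uniform_count_measure)
  have "Pi\<^sub>M {..<k} (\<lambda>_. empirical M N (\<lambda>i. Y i \<omega>)) =
      distr (Pi\<^sub>M {..<k} (\<lambda>_. ?U)) (Pi\<^sub>M {..<k} (\<lambda>_. M)) (compose {..<k} (\<lambda>i. Y i \<omega>))"
    unfolding empirical_def using Y
    by (intro distr_PiM_finite_prob_space'[symmetric]) (auto intro: U.prob_space_axioms M.prob_space_axioms)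
  also have "Pi\<^sub>M {..<k} (\<lambda>_. ?U) = uniform_count_measure ?F"
    using N by (intro PiM_uniform_count_measure) auto
  finally have "bootstrap_law M A f best k N (\<lambda>i. Y i \<omega>) =
      distr (distr (uniform_count_measure ?F) (Pi\<^sub>M {..<k} (\<lambda>_. M)) (compose {..<k} (\<lambda>i. Y i \<omega>))) A (\<lambda>y. f (best k y))"
    by (simp add: bootstrap_law_def best_of_law_def)
  also have "\<dots> = distr (uniform_count_measure ?F) A ((\<lambda>y. f (best k y)) \<circ> compose {..<k} (\<lambda>i. Y i \<omega>))"
    using \<omega> by (intro distr_distr measurable_f_best k)
      (auto simp: measurable_def space_Y space_uniform_count_measure sets_uniform_count_measure space_PiM compose_def)
  also have "(\<lambda>y. f (best k y)) \<circ> compose {..<k} (\<lambda>i. Y i \<omega>) = (\<lambda>a. answer k a \<omega>)"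
    by (auto simp: answer_def compose_def comp_def)
  finally have law: "bootstrap_law M A f best k N (\<lambda>i. Y i \<omega>) = distr (uniform_count_measure ?F) A (\<lambda>a. answer k a \<omega>)" .
  have "measure (bootstrap_law M A f best k N (\<lambda>i. Y i \<omega>)) T =
      measure (uniform_count_measure ?F) {a \<in> ?F. answer k a \<omega> \<in> T}"
    unfolding law using T k \<omega>
    by (subst measure_distr)
      (auto simp: measurable_def space_uniform_count_measure sets_uniform_count_measure vimage_def Int_def conj_commute
        intro: measurable_space[OF measurable_answer])
  also have "\<dots> = real (card {a \<in> ?F. answer k a \<omega> \<in> T}) / real (card ?F)"
    by (intro measure_uniform_count_measure) auto
  also have "real (card {a \<in> ?F. answer k a \<omega> \<in> T}) = (\<Sum>a\<in>?F. indicator T (answer k a \<omega>))"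
    by (simp add: indicator_def sum.If_cases Int_def)
  finally show ?thesis by simp
qed

section \<open>Second moment when the reward has no atoms\<close>

text \<open>If the best output among all those involved sits at a position where \<open>a\<close>
  and \<open>a'\<close> agree, it wins in both lists and the answers coincide. Otherwise its index
  is among the at most \<open>2 * card C\<close> indices at changed positions, each of which is best
  with probability \<open>1 / card S\<close> at most.\<close>

lemma prob_answer_change:
  assumes no_atom: "\<And>t. measure M {y \<in> space M. r y = t} = 0"
    and k: "k > 0" and a': "inj_on a' {..<k}" and T [measurable]: "T \<in> sets A"
  shows "prob {\<omega> \<in> space P. (answer k a \<omega> \<in> T) \<noteq> (answer k a' \<omega> \<in> T)} \<le>
    2 * card {j. j < k \<and> a j \<noteq> a' j} / k"
proof -
  note [measurable] = measurable_answer[OF k]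
  define S where "S = a ` {..<k} \<union> a' ` {..<k}"
  define C where "C = {j. j < k \<and> a j \<noteq> a' j}"
  define B where "B = a ` C \<union> a' ` C"
  define E where "E i = {\<omega> \<in> space P. \<forall>j\<in>S. r (Y j \<omega>) \<le> r (Y i \<omega>)}" for i
  have finS: "finite S" and finB: "finite B" and BS: "B \<subseteq> S"
    by (auto simp: S_def B_def C_def)
  have E [measurable]: "E i \<in> events" for i
    unfolding E_def using finS by measurable
  have "prob {\<omega> \<in> space P. (answer k a \<omega> \<in> T) \<noteq> (answer k a' \<omega> \<in> T)} \<le> prob (\<Union>i\<in>B. E i)"
  proof (rule finite_measure_mono_AE)
    show "AE \<omega> in P. \<omega> \<in> {\<omega> \<in> space P. (answer k a \<omega> \<in> T) \<noteq> (answer k a' \<omega> \<in> T)} \<longrightarrow> \<omega> \<in> (\<Union>i\<in>B. E i)"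
      using AE_distinct_Y[OF r no_atom] AE_space
    proof eventually_elim
      case (elim \<omega>)
      show ?case
      proof (rule impI, rule ccontr)
        assume neq: "\<omega> \<in> {\<omega> \<in> space P. (answer k a \<omega> \<in> T) \<noteq> (answer k a' \<omega> \<in> T)}"
          and "\<omega> \<notin> (\<Union>i\<in>B. E i)"
        then have notB: "\<omega> \<notin> E i" if "i \<in> B" for i
          using that by auto
        have "S \<noteq> {}" using k by (auto simp: S_def)
        then have "Max ((\<lambda>i. r (Y i \<omega>)) ` S) \<in> (\<lambda>i. r (Y i \<omega>)) ` S"
          using finS by (intro Max_in) auto
        then obtain s where s: "Max ((\<lambda>i. r (Y i \<omega>)) ` S) = r (Y s \<omega>)" "s \<in> S"
          by (rule imageE)
        then have "\<omega> \<in> E s"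
          using finS elim by (auto simp: E_def s(1)[symmetric])
        then have "s \<notin> B" using notB by auto
        obtain j where "j < k" "s = a j \<or> s = a' j"
          using s(2) by (auto simp: S_def)
        moreover from this \<open>s \<notin> B\<close> have "a j = a' j"
          by (auto simp: B_def C_def)
        ultimately have j: "j < k" "a j = s" "a' j = s"
          by auto
        \<comment> \<open>Only the index, not the position, of the winner is determined: a resample
          may list the output \<open>s\<close> several times, and the rule may return any of these
          copies.\<close>
        have uniq: "c i = s"
          if c: "c ` {..<k} \<subseteq> S" "c j = s" "i < k" "\<forall>l<k. r (Y (c l) \<omega>) \<le> r (Y (c i) \<omega>)" for c i
        proof -
          have "r (Y s \<omega>) \<le> r (Y (c i) \<omega>)"
            using c(4)[rule_format, OF j(1)] c(2) by simp
          moreover have "r (Y (c i) \<omega>) \<le> r (Y s \<omega>)"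
            using \<open>\<omega> \<in> E s\<close> c by (auto simp: E_def)
          ultimately have "r (Y (c i) \<omega>) = r (Y s \<omega>)"
            by simp
          with elim show ?thesis by blast
        qed
        have "answer k c \<omega> = f (Y s \<omega>)" if "c ` {..<k} \<subseteq> S" "c j = s" for c
          using answer_is_max[OF k elim(2), of c] uniq[of c] that by auto
        from this[of a] this[of a'] j neq show False
          by (auto simp: S_def)
      qed
    qed
    show "(\<Union>i\<in>B. E i) \<in> events"
      using finB by measurable
  qed
  also have "\<dots> \<le> (\<Sum>i\<in>B. prob (E i))"
    using finB by (intro finite_measure_subadditive_finite) auto
  also have "\<dots> \<le> (\<Sum>i\<in>B. 1 / card S)"
    using BS finS unfolding E_def by (intro sum_mono prob_argmax_le[OF r no_atom]) auto
  also have "\<dots> = real (card B) / card S"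
    by simp
  also have "\<dots> \<le> real (2 * card C) / k"
  proof (rule frac_le)
    have "card B \<le> card (a ` C) + card (a' ` C)"
      unfolding B_def by (rule card_Un_le)
    also have "\<dots> \<le> card C + card C"
      by (intro add_mono card_image_le) (auto simp: C_def)
    finally show "real (card B) \<le> real (2 * card C)" by simp
    \<comment> \<open>Injectivity of \<open>a'\<close> guarantees at least \<open>k\<close>
      competing outputs, even if \<open>a\<close> repeats indices.\<close>
    have "card (a' ` {..<k}) \<le> card S"
      using finS by (intro card_mono) (auto simp: S_def)
    then show "real k \<le> real (card S)"
      using a' by (simp add: card_image)
  qed (use k in auto)
  finally show ?thesis by (simp add: C_def)
qed

text \<open>The correlation vanishes for the refreshed pair, and refreshing alters each answer only
  with small probability. An upper bound suffices, since these integrals will be summed to a second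
  moment.\<close>

lemma integral_centred_answers_le:
  assumes no_atom: "\<And>t. measure M {y \<in> space M. r y = t} = 0"
    and k: "k > 0" and ab: "a \<in> resamples k N" "b \<in> resamples k N" and T [measurable]: "T \<in> sets A"
  defines "p \<equiv> measure (best_of_law A f best k M) T"
  shows "(\<integral>\<omega>. (indicator T (answer k a \<omega>) - p) * (indicator T (answer k b \<omega>) - p) \<partial>P) \<le>
    2 * (card (collisions k a b) + card (collisions k b a)) / real k"
proof -
  note [measurable] = measurable_answer[OF k] measurable_best[OF k]
  define X where "X c \<omega> = indicator T (answer k c \<omega>) - p" for c \<omega>
  define D where "D c d = {\<omega> \<in> space P. (answer k c \<omega> \<in> T) \<noteq> (answer k d \<omega> \<in> T)}" for c d
  have N: "a j < N" "b j < N" if "j < k" for j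
    using ab that by auto
  define a' where "a' = refresh k N a b"
  define b' where "b' = refresh k (N + k) b a"
  have inj_a': "inj_on a' {..<k}" and inj_b': "inj_on b' {..<k}"
    unfolding a'_def b'_def by (intro inj_on_refresh; use N in \<open>force intro: trans_less_add1\<close>)+
  have disj: "a' ` {..<k} \<inter> b' ` {..<k} = {}"
    unfolding a'_def b'_def by (intro refresh_disjoint N)
  have p: "0 \<le> p" "p \<le> 1"
    unfolding p_def prob_answer[OF k inj_a' T, symmetric] by auto
  have bound: "\<bar>X c \<omega>\<bar> \<le> 1" for c \<omega>
    using p by (auto simp: X_def indicator_def)
  have X [measurable]: "X c \<in> borel_measurable P" for c
    unfolding X_def by measurable
  have D [measurable]: "D c d \<in> events" for c d
    unfolding D_def by measurable
  have int_X: "integrable P (X c)" for c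
    by (rule integrable_const_bound[where B = 1]) (auto simp: bound)
  have int_XX: "integrable P (\<lambda>\<omega>. X c \<omega> * X d \<omega>)" for c d
    by (rule integrable_const_bound[where B = 1])
      (auto simp: abs_mult intro!: mult_le_one bound)
  have int_D: "integrable P (indicat_real (D c d))" for c d
    by (intro integrable_real_indicator) (auto simp: less_top[symmetric])
  have mean: "(\<integral>\<omega>. X c \<omega> \<partial>P) = 0" if c: "inj_on c {..<k}" for c
  proof -
    have "(\<integral>\<omega>. indicator T (answer k c \<omega>) \<partial>P) = (\<integral>\<omega>. indicator {\<omega> \<in> space P. answer k c \<omega> \<in> T} \<omega> \<partial>P)"
      by (intro Bochner_Integration.integral_cong) (auto simp: indicator_def)
    also have "\<dots> = prob {\<omega> \<in> space P. answer k c \<omega> \<in> T}"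
      by simp
    also have "\<dots> = p"
      unfolding p_def by (rule prob_answer[OF k c T])
    finally show ?thesis
      unfolding X_def
      by (subst Bochner_Integration.integral_diff)
        (auto simp: prob_space intro!: integrable_const_bound[where B = 1] split: split_indicator)
  qed
  have "indep_var borel ((\<lambda>y. indicator T (f (best k y)) - p) \<circ> (\<lambda>\<omega>. \<lambda>j\<in>{..<k}. Y (a' j) \<omega>))
      borel ((\<lambda>y. indicator T (f (best k y)) - p) \<circ> (\<lambda>\<omega>. \<lambda>j\<in>{..<k}. Y (b' j) \<omega>))"
    by (intro indep_var_compose[OF indep_var_selections[OF disj]]) measurable
  then have "indep_var borel (X a') borel (X b')"
    by (simp add: X_def[abs_def] answer_def comp_def)
  \<comment> \<open>The expectation of a product of independent variables factorises, and both
    factors are centred by injectivity.\<close>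
  then have "(\<integral>\<omega>. X a' \<omega> * X b' \<omega> \<partial>P) = 0"
    using int_X mean inj_a' by (subst indep_var_lebesgue_integral) auto
  then have "(\<integral>\<omega>. X a \<omega> * X b \<omega> \<partial>P) = (\<integral>\<omega>. X a \<omega> * X b \<omega> - X a' \<omega> * X b' \<omega> \<partial>P)"
    using int_XX by (subst Bochner_Integration.integral_diff) auto
  also have "\<dots> \<le> (\<integral>\<omega>. indicator (D a a') \<omega> + indicator (D b b') \<omega> \<partial>P)"
  proof (rule integral_mono)
    fix \<omega>
    assume \<omega>: "\<omega> \<in> space P"
    \<comment> \<open>The two replacements are made one after the other; the factor left untouched
      has absolute value at most 1. In each difference \<open>p\<close> cancels, leaving the
      indicator that the answer changed.\<close>
    have "X a \<omega> * X b \<omega> - X a' \<omega> * X b' \<omega> = (X a \<omega> - X a' \<omega>) * X b \<omega> + X a' \<omega> * (X b \<omega> - X b' \<omega>)"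
      by (simp add: algebra_simps)
    also have "\<dots> \<le> \<bar>X a \<omega> - X a' \<omega>\<bar> * 1 + 1 * \<bar>X b \<omega> - X b' \<omega>\<bar>"
    proof (intro add_mono)
      show "(X a \<omega> - X a' \<omega>) * X b \<omega> \<le> \<bar>X a \<omega> - X a' \<omega>\<bar> * 1"
        by (rule order_trans[OF abs_ge_self]) (auto simp only: abs_mult intro!: mult_mono bound)
      show "X a' \<omega> * (X b \<omega> - X b' \<omega>) \<le> 1 * \<bar>X b \<omega> - X b' \<omega>\<bar>"
        by (rule order_trans[OF abs_ge_self]) (auto simp only: abs_mult intro!: mult_mono bound)
    qed
    also have "\<dots> = indicator (D a a') \<omega> + indicator (D b b') \<omega>"
      using \<omega> by (auto simp: X_def D_def indicator_def)
    finally show "X a \<omega> * X b \<omega> - X a' \<omega> * X b' \<omega> \<le> indicator (D a a') \<omega> + indicator (D b b') \<omega>" .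
  qed (use int_XX int_D in auto)
  also have "\<dots> = prob (D a a') + prob (D b b')"
    using int_D by simp
  also have "\<dots> \<le> 2 * card {j. j < k \<and> a j \<noteq> a' j} / k + 2 * card {j. j < k \<and> b j \<noteq> b' j} / k"
    unfolding D_def by (intro add_mono prob_answer_change no_atom k inj_a' inj_b' T)
  also have "\<dots> \<le> 2 * card (collisions k a b) / k + 2 * card (collisions k b a) / k"
    by (intro add_mono divide_right_mono mult_left_mono of_nat_mono card_mono)
      (auto simp: a'_def b'_def refresh_def)
  finally show ?thesis
    by (simp add: X_def add_divide_distrib distrib_left)
qed

lemma measurable_bootstrap_law:
  assumes k: "k > 0" and N: "N > 0" and T [measurable]: "T \<in> sets A"
  shows "(\<lambda>\<omega>. measure (bootstrap_law M A f best k N (\<lambda>i. Y i \<omega>)) T) \<in> borel_measurable P"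
proof -
  note [measurable] = measurable_answer[OF k]
  have "(\<lambda>\<omega>. (\<Sum>a\<in>resamples k N. indicator T (answer k a \<omega>)) / real N ^ k :: real) \<in> borel_measurable P"
    by measurable
  then show ?thesis
    by (subst measurable_cong[OF measure_bootstrap_law[OF k N _ T]])
qed

lemma space_best_of_law [simp]: "space (best_of_law A f best k Q) = space A"
  and sets_best_of_law [simp]: "sets (best_of_law A f best k Q) = sets A"
  by (simp_all add: best_of_law_def)

text \<open>Stated for any law on the sets of \<open>M\<close>, to serve both for \<open>M\<close>
  and for the empirical law.\<close>

lemma prob_space_best_of_law:
  assumes k: "k > 0" and Q: "prob_space Q" "sets Q = sets M"
  shows "prob_space (best_of_law A f best k Q)"
proof -
  have "sets (Pi\<^sub>M {..<k} (\<lambda>_. Q)) = sets (Pi\<^sub>M {..<k} (\<lambda>_. M))"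
    using Q by (intro sets_PiM_cong) auto
  then have "(\<lambda>y. f (best k y)) \<in> measurable (Pi\<^sub>M {..<k} (\<lambda>_. Q)) A"
    using measurable_f_best[OF k] by (simp cong: measurable_cong_sets)
  then show ?thesis
    unfolding best_of_law_def using Q by (intro prob_space.prob_space_distr prob_space_PiM)
qed

lemma prob_space_bootstrap_law:
  assumes k: "k > 0" and N: "N > 0" and \<omega>: "\<omega> \<in> space P"
  shows "prob_space (bootstrap_law M A f best k N (\<lambda>i. Y i \<omega>))"
  unfolding bootstrap_law_def
proof (rule prob_space_best_of_law[OF k])
  have "(\<lambda>i. Y i \<omega>) \<in> measurable (uniform_count_measure {..<N}) M"
    using \<omega> by (auto simp: measurable_def space_Y space_uniform_count_measure sets_uniform_count_measure)
  then show "prob_space (empirical M N (\<lambda>i. Y i \<omega>))"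
    using N unfolding empirical_def
    by (intro prob_space.prob_space_distr prob_space_uniform_count_measure) auto
qed (simp add: empirical_def)

text \<open>The square of an average over resamples is an average over pairs. Each pair costs
  \<open>2 / k\<close> per collision in either direction, and each direction has
  \<open>2 * k * k / N\<close> collisions on average, hence \<open>8 * k / N\<close>.\<close>

lemma bootstrap_second_moment:
  assumes no_atom: "\<And>t. measure M {y \<in> space M. r y = t} = 0"
    and k: "k > 0" and N: "N > 0" and T [measurable]: "T \<in> sets A"
  defines "p \<equiv> measure (best_of_law A f best k M) T"
  shows "(\<integral>\<omega>. (measure (bootstrap_law M A f best k N (\<lambda>i. Y i \<omega>)) T - p)\<^sup>2 \<partial>P) \<le> 8 * real k / real N"
proof -
  note [measurable] = measurable_answer[OF k]
  let ?F = "resamples k N"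
  let ?X = "\<lambda>a \<omega>. indicator T (answer k a \<omega>) - p"
  let ?C = "\<lambda>a b. real (card (collisions k a b))"
  have "(measure (bootstrap_law M A f best k N (\<lambda>i. Y i \<omega>)) T - p)\<^sup>2 =
      (\<Sum>a\<in>?F. \<Sum>b\<in>?F. ?X a \<omega> * ?X b \<omega>) / (real N ^ k)\<^sup>2" if "\<omega> \<in> space P" for \<omega>
  proof -
    have "measure (bootstrap_law M A f best k N (\<lambda>i. Y i \<omega>)) T - p = (\<Sum>a\<in>?F. ?X a \<omega>) / real N ^ k"
      using N by (simp add: measure_bootstrap_law[OF k N that T] sum_subtractf field_simps)
    then show ?thesis
      by (simp only: power_divide power2_eq_square[of "\<Sum>a\<in>?F. ?X a \<omega>"] sum_product)
  qed
  then have "(\<integral>\<omega>. (measure (bootstrap_law M A f best k N (\<lambda>i. Y i \<omega>)) T - p)\<^sup>2 \<partial>P) =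
      (\<integral>\<omega>. (\<Sum>a\<in>?F. \<Sum>b\<in>?F. ?X a \<omega> * ?X b \<omega>) / (real N ^ k)\<^sup>2 \<partial>P)"
    by (intro Bochner_Integration.integral_cong) auto
  also have "\<dots> = (\<Sum>a\<in>?F. \<Sum>b\<in>?F. (\<integral>\<omega>. ?X a \<omega> * ?X b \<omega> \<partial>P)) / (real N ^ k)\<^sup>2"
  proof -
    have "integrable P (\<lambda>\<omega>. ?X a \<omega> * ?X b \<omega>)" for a b
    proof (rule integrable_const_bound[where B = "(1 + \<bar>p\<bar>)\<^sup>2"])
      have "\<bar>?X c \<omega>\<bar> \<le> 1 + \<bar>p\<bar>" for c \<omega>
        using abs_triangle_ineq4[of 1 p] by (simp add: indicator_def)
      then have "\<bar>?X a \<omega>\<bar> * \<bar>?X b \<omega>\<bar> \<le> (1 + \<bar>p\<bar>) * (1 + \<bar>p\<bar>)" for \<omega>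
        by (intro mult_mono) auto
      then show "AE \<omega> in P. norm (?X a \<omega> * ?X b \<omega>) \<le> (1 + \<bar>p\<bar>)\<^sup>2"
        by (simp add: abs_mult power2_eq_square)
    qed measurable
    then show ?thesis
      by (simp add: Bochner_Integration.integral_sum Bochner_Integration.integrable_sum)
  qed
  also have "\<dots> \<le> (\<Sum>a\<in>?F. \<Sum>b\<in>?F. 2 * (?C a b + ?C b a) / k) / (real N ^ k)\<^sup>2"
    using integral_centred_answers_le[OF no_atom k _ _ T] unfolding p_def
    by (intro divide_right_mono sum_mono) auto
  also have "(\<Sum>a\<in>?F. \<Sum>b\<in>?F. 2 * (?C a b + ?C b a) / k) =
      2 * ((\<Sum>a\<in>?F. \<Sum>b\<in>?F. ?C a b) + (\<Sum>a\<in>?F. \<Sum>b\<in>?F. ?C b a)) / k"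
    by (simp add: sum.distrib sum_distrib_left sum_divide_distrib distrib_left add_divide_distrib)
  \<comment> \<open>Exchanging the roles of the two resamples makes both directions of collision
    count alike.\<close>
  also have "(\<Sum>a\<in>?F. \<Sum>b\<in>?F. ?C b a) = (\<Sum>a\<in>?F. \<Sum>b\<in>?F. ?C a b)"
    by (rule sum.swap)
  also have "2 * ((\<Sum>a\<in>?F. \<Sum>b\<in>?F. ?C a b) + (\<Sum>a\<in>?F. \<Sum>b\<in>?F. ?C a b)) / k / (real N ^ k)\<^sup>2 =
      4 / k / (real N ^ k)\<^sup>2 * (\<Sum>a\<in>?F. \<Sum>b\<in>?F. ?C a b)"
    by simp
  also have "\<dots> \<le> 4 / k / (real N ^ k)\<^sup>2 * (2 * (real k)\<^sup>2 / N * (real N ^ k)\<^sup>2)"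
    by (intro mult_left_mono sum_collisions_real N) auto
  also have "\<dots> = 8 * real k / real N"
    using k N by (simp add: power2_eq_square)
  finally show ?thesis .
qed

text \<open>Chebyshev's inequality, with the second moment about the true probability
  \<open>p\<close>.\<close>

lemma bootstrap_deviation:
  assumes no_atom: "\<And>t. measure M {y \<in> space M. r y = t} = 0"
    and k: "k > 0" and N: "N > 0" and T: "T \<in> sets A" and \<delta>: "\<delta> > 0"
  defines "p \<equiv> measure (best_of_law A f best k M) T"
  shows "prob {\<omega> \<in> space P. \<bar>measure (bootstrap_law M A f best k N (\<lambda>i. Y i \<omega>)) T - p\<bar> \<ge> \<delta>} \<le>
    8 * (real k / real N) / \<delta>\<^sup>2"
proof -
  define D where "D \<omega> = measure (bootstrap_law M A f best k N (\<lambda>i. Y i \<omega>)) T - p" for \<omega>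
  have [measurable]: "D \<in> borel_measurable P"
    unfolding D_def using measurable_bootstrap_law[OF k N T] by measurable
  have "\<bar>D \<omega>\<bar> \<le> 1 + \<bar>p\<bar>" if "\<omega> \<in> space P" for \<omega>
    using prob_space.prob_le_1[OF prob_space_bootstrap_law[OF k N that], of T]
      abs_triangle_ineq4[of "measure (bootstrap_law M A f best k N (\<lambda>i. Y i \<omega>)) T" p]
    by (simp add: D_def)
  then have "(D \<omega>)\<^sup>2 \<le> (1 + \<bar>p\<bar>)\<^sup>2" if "\<omega> \<in> space P" for \<omega>
    using that by (simp add: abs_le_square_iff[symmetric])
  then have int: "integrable P (\<lambda>\<omega>. (D \<omega>)\<^sup>2)"
    by (intro integrable_const_bound[where B = "(1 + \<bar>p\<bar>)\<^sup>2"]) auto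
  have "{\<omega> \<in> space P. \<bar>D \<omega>\<bar> \<ge> \<delta>} = {\<omega> \<in> space P. (D \<omega>)\<^sup>2 \<ge> \<delta>\<^sup>2}"
    using \<delta> by (auto simp: abs_le_square_iff[symmetric])
  also have "prob \<dots> \<le> (\<integral>\<omega>. (D \<omega>)\<^sup>2 \<partial>P) / \<delta>\<^sup>2"
    using \<delta> by (intro integral_Markov_inequality_measure[where A = "space P", OF int]) auto
  also have "\<dots> \<le> (8 * real k / real N) / \<delta>\<^sup>2"
    unfolding D_def p_def by (intro divide_right_mono bootstrap_second_moment no_atom k N T) auto
  finally show ?thesis by (simp add: D_def)
qed

section \<open>Answers confined to low rewards\<close>

text \<open>Almost surely an output answering in \<open>T\<close> has reward at most
  \<open>x\<close>; if it wins, all selected outputs stay below \<open>x\<close> as well. The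
  positions without collision carry distinct indices and give independent factors. \<open>b\<close>
  is arbitrary, which lets the collision count for pairs be reused.\<close>

lemma prob_answer_one_sided:
  assumes k: "k > 0" and T: "T \<in> sets A" and x: "AE y in M. x < r y \<longrightarrow> f y \<notin> T"
  shows "prob {\<omega> \<in> space P. answer k a \<omega> \<in> T} \<le>
    measure M {y \<in> space M. r y \<le> x} ^ (k - card (collisions k a b))"
proof -
  define I where "I = {..<k} - collisions k a b"
  have "inj_on a I"
    by (auto simp: inj_on_def I_def collisions_def)
  then have card: "card (a ` I) = k - card (collisions k a b)"
    by (subst card_image) (auto simp: I_def card_Diff_subset collisions_def subset_eq)
  have "prob {\<omega> \<in> space P. answer k a \<omega> \<in> T} \<le>
      prob {\<omega> \<in> space P. \<forall>j\<in>a ` I. Y j \<omega> \<in> {y \<in> space M. r y \<le> x}}"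
  proof (rule finite_measure_mono_AE)
    show "AE \<omega> in P. \<omega> \<in> {\<omega> \<in> space P. answer k a \<omega> \<in> T} \<longrightarrow>
        \<omega> \<in> {\<omega> \<in> space P. \<forall>j\<in>a ` I. Y j \<omega> \<in> {y \<in> space M. r y \<le> x}}"
      using AE_all_Y[OF x] AE_space
    proof eventually_elim
      case (elim \<omega>)
      show ?case
      proof
        assume T: "\<omega> \<in> {\<omega> \<in> space P. answer k a \<omega> \<in> T}"
        obtain j where j: "answer k a \<omega> = f (Y (a j) \<omega>)" "\<forall>i<k. r (Y (a i) \<omega>) \<le> r (Y (a j) \<omega>)"
          using answer_is_max[OF k elim(2)] by blast
        then have "r (Y (a j) \<omega>) \<le> x"
          using T elim(1) by (force simp: not_less[symmetric])
        then have "r (Y (a i) \<omega>) \<le> x" if "i < k" for i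
          using j(2) that order_trans by blast
        then show "\<omega> \<in> {\<omega> \<in> space P. \<forall>j\<in>a ` I. Y j \<omega> \<in> {y \<in> space M. r y \<le> x}}"
          using elim(2) by (auto simp: I_def space_Y)
      qed
    qed
    have "finite (a ` I)" by (simp add: I_def)
    then show "{\<omega> \<in> space P. \<forall>j\<in>a ` I. Y j \<omega> \<in> {y \<in> space M. r y \<le> x}} \<in> events"
      by measurable
  qed
  also have "\<dots> = measure M {y \<in> space M. r y \<le> x} ^ card (a ` I)"
    by (rule prob_Ball_Y) (auto simp: I_def)
  finally show ?thesis by (simp only: card)
qed

text \<open>The true and the estimated probability are nonnegative, so their difference is at most
  their sum, and Markov's inequality applies to the sum. Ties in the reward cause no trouble
  here.\<close>

lemma bootstrap_deviation_one_sided: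
  assumes k: "k > 0" and N: "N > 0" and T [measurable]: "T \<in> sets A" and \<delta>: "\<delta> > 0"
    and x: "AE y in M. x < r y \<longrightarrow> f y \<notin> T"
  defines "p \<equiv> measure (best_of_law A f best k M) T"
    and "q \<equiv> measure M {y \<in> space M. r y \<le> x}"
  shows "prob {\<omega> \<in> space P. \<bar>measure (bootstrap_law M A f best k N (\<lambda>i. Y i \<omega>)) T - p\<bar> \<ge> \<delta>} \<le>
    (2 * q ^ (k div 2) + 4 * (real k / real N)) / \<delta>"
proof -
  note [measurable] = measurable_answer[OF k]
  let ?F = "resamples k N"
  let ?A = "\<lambda>a. {\<omega> \<in> space P. answer k a \<omega> \<in> T}"
  define D where "D \<omega> = measure (bootstrap_law M A f best k N (\<lambda>i. Y i \<omega>)) T" for \<omega>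
  have q: "0 \<le> q" "q \<le> 1"
    by (auto simp: q_def)
  have p: "0 \<le> p" by (simp add: p_def)
  \<comment> \<open>The map \<open>id\<close> is injective and never takes the value
    \<open>k\<close> on \<open>{..<k}\<close>, so this choice has no collisions and the exponent is
    the full \<open>k\<close>.\<close>
  have "prob (?A id) \<le> q ^ (k - card (collisions k id (\<lambda>_. k)))"
    unfolding q_def by (rule prob_answer_one_sided[OF k T x])
  also have "collisions k id (\<lambda>_. k) = {}"
    by (auto simp: collisions_def)
  also have "prob (?A id) = p"
    unfolding p_def by (rule prob_answer[OF k _ T]) simp
  also have "q ^ (k - card ({} :: nat set)) \<le> q ^ (k div 2)"
    using q by (intro power_decreasing) auto
  finally have p_le: "p \<le> q ^ (k div 2)" .
  have D_nonneg: "0 \<le> D \<omega>" for \<omega>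
    by (simp add: D_def)
  have D: "D \<omega> = (\<Sum>a\<in>?F. indicator (?A a) \<omega>) / real N ^ k" if "\<omega> \<in> space P" for \<omega>
    using that by (simp add: D_def measure_bootstrap_law[OF k N that T] indicator_def)
  have int_A: "integrable P (\<lambda>\<omega>. indicat_real (?A a) \<omega>)" for a
    by (intro integrable_real_indicator) (auto simp: less_top[symmetric])
  have int_D: "integrable P D"
    by (subst Bochner_Integration.integrable_cong[OF refl D])
      (auto intro!: Bochner_Integration.integrable_sum int_A)
  have "(\<integral>\<omega>. D \<omega> \<partial>P) = (\<integral>\<omega>. (\<Sum>a\<in>?F. indicator (?A a) \<omega>) / real N ^ k \<partial>P)"
    by (intro Bochner_Integration.integral_cong D refl)
  also have "\<dots> = (\<Sum>a\<in>?F. prob (?A a)) / real N ^ k"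
    using int_A by (simp add: Bochner_Integration.integral_sum)
  \<comment> \<open>A dummy average over \<open>b\<close> is inserted to match the collision count
    over pairs.\<close>
  also have "\<dots> = (\<Sum>a\<in>?F. \<Sum>b\<in>?F. prob (?A a)) / (real N ^ k)\<^sup>2"
    using N by (simp add: power2_eq_square sum_distrib_left[symmetric])
  also have "\<dots> \<le> (\<Sum>a\<in>?F. \<Sum>b\<in>?F. q ^ (k div 2) + 2 * real (card (collisions k a b)) / k) / (real N ^ k)\<^sup>2"
  proof (intro divide_right_mono sum_mono)
    fix a b
    have "prob (?A a) \<le> q ^ (k - card (collisions k a b))"
      unfolding q_def by (rule prob_answer_one_sided[OF k T x])
    also have "\<dots> \<le> q ^ (k div 2) + 2 * real (card (collisions k a b)) / k"
      by (rule power_diff_le[OF q k])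
    finally show "prob (?A a) \<le> q ^ (k div 2) + 2 * real (card (collisions k a b)) / k" .
  qed simp
  also have "(\<Sum>a\<in>?F. \<Sum>b\<in>?F. q ^ (k div 2) + 2 * real (card (collisions k a b)) / k) =
      (real N ^ k)\<^sup>2 * q ^ (k div 2) + 2 / k * (\<Sum>a\<in>?F. \<Sum>b\<in>?F. card (collisions k a b))"
    by (simp add: sum.distrib sum_distrib_left power2_eq_square)
  also have "\<dots> \<le> (real N ^ k)\<^sup>2 * q ^ (k div 2) + 2 / k * (2 * (real k)\<^sup>2 / N * (real N ^ k)\<^sup>2)"
    using sum_collisions_real[OF N] by (intro add_left_mono mult_left_mono) auto
  also have "\<dots> / (real N ^ k)\<^sup>2 = q ^ (k div 2) + 4 * (real k / real N)"
    using k N by (simp add: field_simps power2_eq_square)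
  finally have mean: "(\<integral>\<omega>. D \<omega> \<partial>P) \<le> q ^ (k div 2) + 4 * (real k / real N)"
    by (simp add: divide_right_mono)
  have "prob {\<omega> \<in> space P. \<bar>D \<omega> - p\<bar> \<ge> \<delta>} \<le> prob {\<omega> \<in> space P. D \<omega> + p \<ge> \<delta>}"
  proof (rule finite_measure_mono)
    have "\<bar>D \<omega> - p\<bar> \<le> D \<omega> + p" for \<omega>
      using p D_nonneg[of \<omega>] by linarith
    then show "{\<omega> \<in> space P. \<bar>D \<omega> - p\<bar> \<ge> \<delta>} \<subseteq> {\<omega> \<in> space P. D \<omega> + p \<ge> \<delta>}"
      by (auto intro: order_trans)
    show "{\<omega> \<in> space P. D \<omega> + p \<ge> \<delta>} \<in> events"
      using int_D by measurable
  qed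
  also have "\<dots> \<le> (\<integral>\<omega>. D \<omega> + p \<partial>P) / \<delta>"
    using int_D \<delta> p D_nonneg
    by (intro integral_Markov_inequality_measure[where A = "space P"]) auto
  also have "(\<integral>\<omega>. D \<omega> + p \<partial>P) = (\<integral>\<omega>. D \<omega> \<partial>P) + p"
    using int_D by (simp add: prob_space)
  also have "\<dots> \<le> 2 * q ^ (k div 2) + 4 * (real k / real N)"
    using mean p_le by simp
  finally show ?thesis
    using \<delta> by (simp add: D_def divide_right_mono)
qed

section \<open>Convergence in probability for single answers and in total\<close>

text \<open>\<open>T\<close> is a set rather than one answer, so that the set of all other answers
  can be treated too.\<close>

definition deviation :: "(nat \<Rightarrow> nat) \<Rightarrow> 'a set \<Rightarrow> nat \<Rightarrow> 'w \<Rightarrow> real" where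
  "deviation m T N \<omega> = measure (bootstrap_law M A f best (m N) N (\<lambda>i. Y i \<omega>)) T -
     measure (best_of_law A f best (m N) M) T"

lemma deviation_tendsto_no_atom:
  assumes no_atom: "\<And>t. measure M {y \<in> space M. r y = t} = 0"
    and m: "\<And>N. m N > 0" "(\<lambda>N. real (m N) / real N) \<longlonglongrightarrow> 0"
    and T: "T \<in> sets A" and \<delta>: "\<delta> > 0"
  shows "(\<lambda>N. prob {\<omega> \<in> space P. \<bar>deviation m T N \<omega>\<bar> \<ge> \<delta>}) \<longlonglongrightarrow> 0"
proof (rule tendsto_sandwich[where f = "\<lambda>_. 0"])
  show "\<forall>\<^sub>F N in sequentially. prob {\<omega> \<in> space P. \<bar>deviation m T N \<omega>\<bar> \<ge> \<delta>} \<le>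
      8 * (real (m N) / real N) / \<delta>\<^sup>2"
    using eventually_gt_at_top[of 0]
    by eventually_elim (simp only: deviation_def bootstrap_deviation[OF no_atom m(1) _ T \<delta>])
  show "(\<lambda>N. 8 * (real (m N) / real N) / \<delta>\<^sup>2) \<longlonglongrightarrow> 0"
    using tendsto_divide[OF tendsto_mult_right_zero[OF m(2), of 8] tendsto_const[of "\<delta>\<^sup>2"]] \<delta> by simp
qed auto

lemma deviation_tendsto_one_sided:
  assumes x: "AE y in M. x < r y \<longrightarrow> f y \<notin> T" "measure M {y \<in> space M. r y \<le> x} < 1"
    and m: "\<And>N. m N > 0" "filterlim m at_top sequentially" "(\<lambda>N. real (m N) / real N) \<longlonglongrightarrow> 0"
    and T: "T \<in> sets A" and \<delta>: "\<delta> > 0"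
  shows "(\<lambda>N. prob {\<omega> \<in> space P. \<bar>deviation m T N \<omega>\<bar> \<ge> \<delta>}) \<longlonglongrightarrow> 0"
proof (rule tendsto_sandwich[where f = "\<lambda>_. 0"])
  let ?q = "measure M {y \<in> space M. r y \<le> x}"
  show "\<forall>\<^sub>F N in sequentially. prob {\<omega> \<in> space P. \<bar>deviation m T N \<omega>\<bar> \<ge> \<delta>} \<le>
      (2 * ?q ^ (m N div 2) + 4 * (real (m N) / real N)) / \<delta>"
    using eventually_gt_at_top[of 0]
    by eventually_elim (simp only: deviation_def bootstrap_deviation_one_sided[OF m(1) _ T \<delta> x(1)])
  have half: "filterlim (\<lambda>N. m N div 2) at_top sequentially"
    unfolding filterlim_at_top
  proof
    fix Z
    show "\<forall>\<^sub>F N in sequentially. Z \<le> m N div 2"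
      using filterlim_at_top[THEN iffD1, OF m(2), rule_format, of "2 * Z"] by eventually_elim simp
  qed
  have "(\<lambda>N. ?q ^ (m N div 2)) \<longlonglongrightarrow> 0"
    using x(2) by (intro filterlim_compose[OF LIMSEQ_power_zero half]) simp
  then have "(\<lambda>N. (2 * ?q ^ (m N div 2) + 4 * (real (m N) / real N)) / \<delta>) \<longlonglongrightarrow> (2 * 0 + 4 * 0) / \<delta>"
    using m(3) \<delta> by (intro tendsto_intros) auto
  then show "(\<lambda>N. (2 * ?q ^ (m N div 2) + 4 * (real (m N) / real N)) / \<delta>) \<longlonglongrightarrow> 0"
    by simp
qed auto

text \<open>Both laws have total mass 1. This handles the case where the answers other than
  \<open>z\<close> are the ones confined to low rewards.\<close>

lemma deviation_compl:
  assumes m: "m N > 0" and N: "N > 0" and T: "T \<in> sets A" and \<omega>: "\<omega> \<in> space P"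
  shows "deviation m (space A - T) N \<omega> = - deviation m T N \<omega>"
proof -
  interpret B: prob_space "bootstrap_law M A f best (m N) N (\<lambda>i. Y i \<omega>)"
    by (rule prob_space_bootstrap_law[OF m N \<omega>])
  interpret L: prob_space "best_of_law A f best (m N) M"
    by (rule prob_space_best_of_law[OF m M.prob_space_axioms refl])
  show ?thesis
    using B.prob_compl[of T] L.prob_compl[of T] T by (simp add: deviation_def bootstrap_law_def)
qed

text \<open>Almost surely every output of the sequence answers in \<open>V\<close>, hence so does
  each Best-of answer; both laws vanish off \<open>V\<close> and the infinite sum becomes
  finite.\<close>

lemma AE_l1_dist_eq:
  assumes sing: "\<And>z. z \<in> space A \<Longrightarrow> {z} \<in> sets A"
    and V: "finite V" "V \<subseteq> space A" "AE y in M. f y \<in> V"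
    and m: "m N > 0" and N: "N > 0"
  shows "AE \<omega> in P. l1_dist A (bootstrap_law M A f best (m N) N (\<lambda>i. Y i \<omega>)) (best_of_law A f best (m N) M) =
    (\<Sum>z\<in>V. \<bar>deviation m {z} N \<omega>\<bar>)"
proof -
  \<comment> \<open>One null set serves all index maps \<open>a\<close>, because it only concerns
    the countably many outputs.\<close>
  have answer: "AE \<omega> in P. \<forall>a. answer (m N) a \<omega> \<in> V"
    using AE_all_Y[OF V(3)] AE_space
  proof eventually_elim
    case (elim \<omega>)
    then show ?case
      using answer_is_max[OF m elim(2)] by metis
  qed
  have law_0: "measure (best_of_law A f best (m N) M) {z} = 0" if z: "z \<in> space A - V" for z
  proof -
    note [measurable] = measurable_answer[OF m]
    have [measurable]: "{z} \<in> sets A" using sing z by simp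
    have "AE \<omega> in P. \<omega> \<notin> {\<omega> \<in> space P. answer (m N) id \<omega> \<in> {z}}"
      using answer by eventually_elim (use z in auto)
    then have "prob {\<omega> \<in> space P. answer (m N) id \<omega> \<in> {z}} = 0"
      by (subst prob_eq_0) auto
    then show ?thesis
      using prob_answer[OF m, of id "{z}"] by simp
  qed
  show ?thesis
    using answer AE_space
  proof eventually_elim
    case (elim \<omega>)
    have "measure (bootstrap_law M A f best (m N) N (\<lambda>i. Y i \<omega>)) {z} = 0" if z: "z \<in> space A - V" for z
    proof -
      have "answer (m N) a \<omega> \<noteq> z" for a
        using elim(1) z by auto
      then show ?thesis
        using z by (simp add: measure_bootstrap_law[OF m N elim(2) sing])
    qed
    then have "l1_dist A (bootstrap_law M A f best (m N) N (\<lambda>i. Y i \<omega>)) (best_of_law A f best (m N) M) =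
        (\<Sum>\<^sub>\<infinity>z\<in>V. \<bar>deviation m {z} N \<omega>\<bar>)"
      unfolding l1_dist_def using V(2) law_0 by (intro infsum_cong_neutral) (auto simp: deviation_def)
    then show ?case
      using V(1) by simp
  qed
qed

lemma l1_dist_tendsto:
  assumes sing: "\<And>z. z \<in> space A \<Longrightarrow> {z} \<in> sets A"
    and V: "finite V" "V \<subseteq> space A" "AE y in M. f y \<in> V"
    and m: "\<And>N. m N > 0"
    and dev: "\<And>z \<delta>. z \<in> V \<Longrightarrow> \<delta> > 0 \<Longrightarrow> (\<lambda>N. prob {\<omega> \<in> space P. \<bar>deviation m {z} N \<omega>\<bar> \<ge> \<delta>}) \<longlonglongrightarrow> 0"
    and \<epsilon>: "\<epsilon> > 0"
  shows "(\<lambda>N. prob {\<omega> \<in> space P. l1_dist A (bootstrap_law M A f best (m N) N (\<lambda>i. Y i \<omega>))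
      (best_of_law A f best (m N) M) \<ge> \<epsilon>}) \<longlonglongrightarrow> 0"
proof (rule tendsto_sandwich[where f = "\<lambda>_. 0"])
  \<comment> \<open>The added 1 makes \<open>card V * \<delta>\<close> strictly less than
    \<open>\<epsilon>\<close> and covers an empty \<open>V\<close>.\<close>
  define \<delta> where "\<delta> = \<epsilon> / (real (card V) + 1)"
  have \<delta>: "\<delta> > 0" using \<epsilon> by (simp add: \<delta>_def)
  show "\<forall>\<^sub>F N in sequentially. prob {\<omega> \<in> space P. l1_dist A (bootstrap_law M A f best (m N) N (\<lambda>i. Y i \<omega>))
      (best_of_law A f best (m N) M) \<ge> \<epsilon>} \<le> (\<Sum>z\<in>V. prob {\<omega> \<in> space P. \<bar>deviation m {z} N \<omega>\<bar> \<ge> \<delta>})"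
    using eventually_gt_at_top[of 0]
  proof eventually_elim
    case (elim N)
    let ?B = "\<lambda>z. {\<omega> \<in> space P. \<bar>deviation m {z} N \<omega>\<bar> \<ge> \<delta>}"
    have B: "?B z \<in> events" if "z \<in> V" for z
    proof -
      have "(\<lambda>\<omega>. deviation m {z} N \<omega>) \<in> borel_measurable P"
        unfolding deviation_def using measurable_bootstrap_law[OF m elim sing, of z] V(2) that by auto
      then show ?thesis by measurable
    qed
    have l1: "AE \<omega> in P. l1_dist A (bootstrap_law M A f best (m N) N (\<lambda>i. Y i \<omega>))
        (best_of_law A f best (m N) M) = (\<Sum>z\<in>V. \<bar>deviation m {z} N \<omega>\<bar>)"
      by (rule AE_l1_dist_eq[where m = m and N = N, OF _ V m elim]) (rule sing)
    have "prob {\<omega> \<in> space P. l1_dist A (bootstrap_law M A f best (m N) N (\<lambda>i. Y i \<omega>))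
        (best_of_law A f best (m N) M) \<ge> \<epsilon>} \<le> prob (\<Union>z\<in>V. ?B z)"
    \<comment> \<open>Only the larger event has to be measurable, so no measurability of the
      infinite sum in \<open>l1_dist\<close> is required.\<close>
    proof (rule finite_measure_mono_AE)
      show "AE \<omega> in P. \<omega> \<in> {\<omega> \<in> space P. l1_dist A (bootstrap_law M A f best (m N) N (\<lambda>i. Y i \<omega>))
          (best_of_law A f best (m N) M) \<ge> \<epsilon>} \<longrightarrow> \<omega> \<in> (\<Union>z\<in>V. ?B z)"
        using l1
      proof eventually_elim
        case (elim \<omega>)
        show ?case
        proof (rule impI, rule ccontr)
          assume \<omega>: "\<omega> \<in> {\<omega> \<in> space P. l1_dist A (bootstrap_law M A f best (m N) N (\<lambda>i. Y i \<omega>))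
            (best_of_law A f best (m N) M) \<ge> \<epsilon>}" and "\<omega> \<notin> (\<Union>z\<in>V. ?B z)"
          then have "(\<Sum>z\<in>V. \<bar>deviation m {z} N \<omega>\<bar>) \<le> (\<Sum>z\<in>V. \<delta>)"
            by (intro sum_mono) (auto simp: not_le intro: less_imp_le)
          also have "\<dots> < \<epsilon>"
            using \<epsilon> by (simp add: \<delta>_def field_simps)
          finally show False
            using \<omega> elim by simp
        qed
      qed
      show "(\<Union>z\<in>V. ?B z) \<in> events"
        using V(1) B by (intro sets.finite_UN) auto
    qed
    also have "\<dots> \<le> (\<Sum>z\<in>V. prob (?B z))"
      using V(1) B by (intro finite_measure_subadditive_finite) auto
    finally show ?case .
  qed
  show "(\<lambda>N. \<Sum>z\<in>V. prob {\<omega> \<in> space P. \<bar>deviation m {z} N \<omega>\<bar> \<ge> \<delta>}) \<longlonglongrightarrow> 0"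
    by (intro tendsto_null_sum dev \<delta>)
qed auto

end

theorem theorem3:
  fixes M :: "'y measure" and A :: "'a measure" and P :: "'w measure"
    and f :: "'y \<Rightarrow> 'a" and r :: "'y \<Rightarrow> real"
    and best :: "nat \<Rightarrow> (nat \<Rightarrow> 'y) \<Rightarrow> 'y"
    and Y :: "nat \<Rightarrow> 'w \<Rightarrow> 'y" and m :: "nat \<Rightarrow> nat"
  assumes "prob_space M"
    and "f \<in> measurable M A"
    and "\<And>z. z \<in> space A \<Longrightarrow> {z} \<in> sets A"
    and "r \<in> borel_measurable M"
    and "best_of_rule M r best"
    and "prob_space P"
    and "prob_space.indep_vars P (\<lambda>_. M) Y UNIV"
    and "\<And>i. distr P M (Y i) = M"
    and "finite (possible_answers M A f)"
    and "AE y in M. f y \<in> possible_answers M A f"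
    and "\<And>z. z \<in> possible_answers M A f \<Longrightarrow> measure (distr M A f) {z} \<in> {0<..<1}"
    and "\<And>z. z \<in> possible_answers M A f \<Longrightarrow>
      (let F0 = cond_cdf M r (\<lambda>y. f y = z);
           F1 = cond_cdf M r (\<lambda>y. f y \<noteq> z);
           x0 = right_endpoint F0;
           x1 = right_endpoint F1
       in x0 < x1 \<or> x0 > x1 \<or>
          (x0 = x1 \<and>
           (\<forall>F\<in>{F0, F1}. continuous_on UNIV F \<and> strict_mono_on {x. 0 < F x \<and> F x < 1} F) \<and>
           (\<exists>c::ereal. 0 \<le> c \<and>
              ((\<lambda>x. ereal ((1 - F0 x) / (1 - F1 x))) \<longlongrightarrow> c) (real_at_left x0))))"
    and "\<And>N. m N > 0"
    and "filterlim m at_top sequentially"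
    and "(\<lambda>N. real (m N) / real N) \<longlonglongrightarrow> 0"
  shows "\<forall>\<epsilon>>0. (\<lambda>N. measure P {\<omega> \<in> space P.
           l1_dist A (bootstrap_law M A f best (m N) N (\<lambda>i. Y i \<omega>))
                     (best_of_law A f best (m N) M) \<ge> \<epsilon>}) \<longlonglongrightarrow> 0"
proof (intro allI impI)
  fix \<epsilon> :: real
  assume \<epsilon>: "\<epsilon> > 0"
  interpret best_of P M Y A f r best
    using assms by (auto simp: best_of_def best_of_axioms_def iid_sample_def iid_sample_axioms_def)
  note sing = assms(3) and tie = assms(12) and m = assms(13-15)
  let ?V = "possible_answers M A f"
  show "(\<lambda>N. prob {\<omega> \<in> space P. l1_dist A (bootstrap_law M A f best (m N) N (\<lambda>i. Y i \<omega>))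
      (best_of_law A f best (m N) M) \<ge> \<epsilon>}) \<longlonglongrightarrow> 0"
  proof (rule l1_dist_tendsto[OF sing assms(9) _ assms(10) m(1) _ \<epsilon>])
    show "?V \<subseteq> space A"
      by (auto simp: possible_answers_def)
    fix z and \<delta> :: real
    assume z: "z \<in> ?V" and \<delta>: "\<delta> > 0"
    then have zA [measurable]: "{z} \<in> sets A"
      using sing by (auto simp: possible_answers_def)
    have E0 [measurable]: "{y \<in> space M. f y = z} \<in> sets M"
      using measurable_sets[OF f zA] by (simp add: vimage_def Int_def conj_commute)
    have E1 [measurable]: "{y \<in> space M. f y \<noteq> z} \<in> sets M"
      using sets.compl_sets[OF E0] by (simp add: set_diff_eq conj_commute cong: conj_cong)
    have "measure M {y \<in> space M. f y = z} = measure (distr M A f) {z}"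
      by (simp add: measure_distr vimage_def Int_def conj_commute)
    then have p: "0 < measure M {y \<in> space M. f y = z}" "measure M {y \<in> space M. f y = z} < 1"
      using assms(11)[OF z] by auto
    have "measure M {y \<in> space M. f y \<noteq> z} = 1 - measure M {y \<in> space M. f y = z}"
      using M.prob_neg[of "\<lambda>y. f y = z"] by simp
    with p have p1: "0 < measure M {y \<in> space M. f y \<noteq> z}"
      by simp
    let ?F0 = "cond_cdf M r (\<lambda>y. f y = z)" and ?F1 = "cond_cdf M r (\<lambda>y. f y \<noteq> z)"
    \<comment> \<open>Different endpoints confine either \<open>z\<close> or its competitors to low
      rewards; in the third case continuity of both conditional CDFs excludes ties.\<close>
    consider (less) "right_endpoint ?F0 < right_endpoint ?F1"
      | (greater) "right_endpoint ?F1 < right_endpoint ?F0"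
      | (cont) "continuous_on UNIV ?F0" "continuous_on UNIV ?F1"
      using tie[OF z] unfolding Let_def by blast
    then show "(\<lambda>N. prob {\<omega> \<in> space P. \<bar>deviation m {z} N \<omega>\<bar> \<ge> \<delta>}) \<longlonglongrightarrow> 0"
    proof cases
      case less
      obtain x where x: "measure M {y \<in> space M. r y \<le> x} < 1" "AE y in M. x < r y \<longrightarrow> f y \<noteq> z"
        using right_endpoint_less[OF M.prob_space_axioms r E0 p(1) E1 p1 _ less] by auto
      then show ?thesis
        by (intro deviation_tendsto_one_sided[OF _ x(1) m zA \<delta>]) simp
    next
      case greater
      obtain x where x: "measure M {y \<in> space M. r y \<le> x} < 1" "AE y in M. x < r y \<longrightarrow> \<not> f y \<noteq> z"
        using right_endpoint_less[OF M.prob_space_axioms r E1 p1 E0 p(1) _ greater] by auto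
      \<comment> \<open>Above \<open>x\<close> only the answer \<open>z\<close> occurs, so the
        one-sided bound holds for the complement of \<open>{z}\<close> and is then carried over to
        \<open>{z}\<close>.\<close>
      have "(\<lambda>N. prob {\<omega> \<in> space P. \<bar>deviation m (space A - {z}) N \<omega>\<bar> \<ge> \<delta>}) \<longlonglongrightarrow> 0"
        using x by (intro deviation_tendsto_one_sided[OF _ x(1) m _ \<delta>]) auto
      moreover have "\<forall>\<^sub>F N in sequentially.
          prob {\<omega> \<in> space P. \<bar>deviation m (space A - {z}) N \<omega>\<bar> \<ge> \<delta>} =
          prob {\<omega> \<in> space P. \<bar>deviation m {z} N \<omega>\<bar> \<ge> \<delta>}"
        using eventually_gt_at_top[of 0]
        by eventually_elim (auto simp: deviation_compl[where m = m, OF m(1) _ zA] intro!: arg_cong[where f = prob])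
      ultimately show ?thesis
        by (rule Lim_transform_eventually)
    next
      case cont
      \<comment> \<open>An atom of the reward law would put mass on one of the two sides and make
        the corresponding conditional CDF jump.\<close>
      have "measure M {y \<in> space M. r y = t} = 0" for t
      proof -
        have "measure M {y \<in> space M. f y = z \<and> r y = t} = 0"
          using cont(1) cond_cdf_eq(2)[OF M.prob_space_axioms r E0 p(1), of t]
          by (simp add: continuous_on_eq_continuous_at)
        moreover have "measure M {y \<in> space M. f y \<noteq> z \<and> r y = t} = 0"
          using cont(2) cond_cdf_eq(2)[OF M.prob_space_axioms r E1 p1, of t]
          by (simp add: continuous_on_eq_continuous_at)
        moreover have "measure M {y \<in> space M. r y = t} \<le>
            measure M {y \<in> space M. f y = z \<and> r y = t} + measure M {y \<in> space M. f y \<noteq> z \<and> r y = t}"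
          by (rule order_trans[OF M.finite_measure_mono measure_Un_le]) auto
        ultimately show ?thesis
          using measure_nonneg[of M "{y \<in> space M. r y = t}"] by linarith
      qed
      then show ?thesis
        by (rule deviation_tendsto_no_atom[OF _ m(1) m(3) zA \<delta>])
    qed
  qed
qed

end
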